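(* Let $G=(V,m,E,a)$ be an undirected weighted graph with a collection of undirected clusters $\{\hat E_i\}_{i\in I}$, $\hat E=\bigcup_{i\in I}\hat E_i$, and let $G_\beta=(V,m,E,a_\beta)$, $\beta\in[0,\infty)$, be a family of undirected graphs with $a_0=a$, such that for $\tilde\beta>\beta$ one has $a_{\tilde\beta}(i,j)=a(i,j)$ if $(i,j)\in E\setminus\hat E$ and $a_{\tilde\beta}(i,j)>a_\beta(i,j)$ if $(i,j)\in\hat E$, and such that $a_\beta(i,j)\to\infty$ as $\beta\to\infty$ for every $(i,j)\in\hat E$. Let $L_\beta$ be the graph Laplacian of $G_\beta$, and $\underline L$ the graph Laplacian of the reduced graph $\underline G$. Then for every $t>0$, $e^{-tL_\beta}\to J_\uparrow e^{-t\underline L}J_\downarrow$ strongly as $\beta\to\infty$.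
   Context: A weighted graph $G=(V,m,E,a)$ consists of an at most countably infinite vertex set $V$, node masses $m:V\to(0,\infty)$, a locally finite edge set $E\subseteq V\times V$, and a weight function $a:V\times V\to[0,\infty)$ with $a(v,w)>0$ iff $(v,w)\in E$. It is undirected if $E$ and $a$ are symmetric. $\ell^2(G)=\{f:V\to\mathbb C:\sum_v|f(v)|^2m(v)<\infty\}$ with $\langle f,g\rangle_{\ell^2(G)}=\sum_x\overline{f(x)}g(x)m(x)$. The graph Laplacian of an undirected graph is $[Lf](x)=\frac1{m(x)}\big(d(x)f(x)-\sum_{y}a(x,y)f(y)\big)$ with $d(x)=\sum_y a(x,y)$. Standing assumption: for each graph considered ($G$ and every $G_\beta$) there is a constant $C>0$ (possibly depending on the graph) with $d(v)\le C\,m(v)$ for all $v$; thus all Laplacians $L_\beta$ are bounded on $\ell^2(G)$. Collection of undirected clusters: a countable family of (symmetric, nonempty) edge sets $\hat E_i\subseteq E$, $i\in I$, with node sets $V_i$ (the set of vertices incident to an edge of $\hat E_i$), such that (i) $\sum_{v\in V_i}m(v)<\infty$ for each $i$; (ii) the $V_i$ are pairwise disjoint; (iii) each $(V_i,\hat E_i)$ is connected. Reduced graph $\underline G=(\underline V,\underline m,\underline E,\underline a)$: $\underline V$ is the set of connected components $C\subseteq V$ of $(V,\hat E)$ (a component may be a single vertex not incident to any edge of $\hat E$); $\underline m(C)=\sum_{v\in C}m(v)$; $\underline a(C,D)=\sum_{v\in C,\,w\in D}a(v,w)$; $\underline E=\{(C,D):\underline a(C,D)>0\}$. Its Laplacian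 $\underline L$ acts on $\ell^2(\underline G)$ by the same formula. $J_\downarrow:\ell^2(G)\to\ell^2(\underline G)$, $[J_\downarrow f](C)=\langle\chi_C,f\rangle_{\ell^2(G)}/\underline m(C)$, and $J_\uparrow:\ell^2(\underline G)\to\ell^2(G)$, $J_\uparrow\underline f=\sum_{C\in\underline V}\underline f(C)\chi_C$, where $\chi_C$ is the indicator function of $C$. *)

theory Defs
  imports "HOL-Analysis.Analysis"
begin

record 'v wgraph =
  verts :: "'v set"
  mass :: "'v \<Rightarrow> real"
  edges :: "('v \<times> 'v) set"
  weight :: "'v \<Rightarrow> 'v \<Rightarrow> real"

definition weighted_graph :: "'v wgraph \<Rightarrow> bool" where
  "weighted_graph G \<longleftrightarrow>
     countable (verts G) \<and>
     (\<forall>v\<in>verts G. mass G v > 0) \<and>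
     edges G \<subseteq> verts G \<times> verts G \<and>
     (\<forall>v\<in>verts G. finite {w. (v, w) \<in> edges G} \<and> finite {w. (w, v) \<in> edges G}) \<and>
     (\<forall>v\<in>verts G. \<forall>w\<in>verts G.
        weight G v w \<ge> 0 \<and> (weight G v w > 0 \<longleftrightarrow> (v, w) \<in> edges G))"

definition undirected :: "'v wgraph \<Rightarrow> bool" where
  "undirected G \<longleftrightarrow>
     sym (edges G) \<and> (\<forall>v\<in>verts G. \<forall>w\<in>verts G. weight G v w = weight G w v)"

definition degree :: "'v wgraph \<Rightarrow> 'v \<Rightarrow> real" where
  "degree G v = (\<Sum>\<^sub>\<infinity>w\<in>verts G. weight G v w)"

definition degree_bounded :: "'v wgraph \<Rightarrow> bool" where
  "degree_bounded G \<longleftrightarrow> (\<exists>C>0. \<forall>v\<in>verts G. degree G v \<le> C * mass G v)"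

text \<open>A function on the vertex set is represented by its extension by 0 to the whole type;
  with this convention it is determined by its values on the vertices.\<close>

definition ell2 :: "'v wgraph \<Rightarrow> ('v \<Rightarrow> complex) set" where
  "ell2 G = {f. (\<forall>v. v \<notin> verts G \<longrightarrow> f v = 0) \<and>
                (\<lambda>v. (cmod (f v))\<^sup>2 * mass G v) summable_on verts G}"

definition ell2_inner :: "'v wgraph \<Rightarrow> ('v \<Rightarrow> complex) \<Rightarrow> ('v \<Rightarrow> complex) \<Rightarrow> complex" where
  "ell2_inner G f g = (\<Sum>\<^sub>\<infinity>v\<in>verts G. cnj (f v) * g v * of_real (mass G v))"

definition ell2_norm :: "'v wgraph \<Rightarrow> ('v \<Rightarrow> complex) \<Rightarrow> real" where
  "ell2_norm G f = sqrt (\<Sum>\<^sub>\<infinity>v\<in>verts G. (cmod (f v))\<^sup>2 * mass G v)"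

text \<open>The membership conditions are needed because an infinite sum that diverges has
  the value 0, so that the norm carries no information outside the space.\<close>

definition ell2_tendsto ::
    "'v wgraph \<Rightarrow> ('b \<Rightarrow> 'v \<Rightarrow> complex) \<Rightarrow> ('v \<Rightarrow> complex) \<Rightarrow> 'b filter \<Rightarrow> bool" where
  "ell2_tendsto G F g \<F> \<longleftrightarrow>
     g \<in> ell2 G \<and> (\<forall>\<^sub>F x in \<F>. F x \<in> ell2 G) \<and>
     ((\<lambda>x. ell2_norm G (\<lambda>v. F x v - g v)) \<longlongrightarrow> 0) \<F>"

definition strong_op_tendsto ::
    "'v wgraph \<Rightarrow> ('b \<Rightarrow> ('v \<Rightarrow> complex) \<Rightarrow> ('v \<Rightarrow> complex)) \<Rightarrow>
     (('v \<Rightarrow> complex) \<Rightarrow> ('v \<Rightarrow> complex)) \<Rightarrow> 'b filter \<Rightarrow> bool" where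
  "strong_op_tendsto G T S \<F> \<longleftrightarrow> (\<forall>f\<in>ell2 G. ell2_tendsto G (\<lambda>x. T x f) (S f) \<F>)"

definition laplacian :: "'v wgraph \<Rightarrow> ('v \<Rightarrow> complex) \<Rightarrow> ('v \<Rightarrow> complex)" where
  "laplacian G f x =
     (if x \<in> verts G
      then 1 / of_real (mass G x) *
           (of_real (degree G x) * f x - (\<Sum>\<^sub>\<infinity>y\<in>verts G. of_real (weight G x y) * f y))
      else 0)"

text \<open>The exponential of a bounded operator \<open>A\<close> on \<open>ell2 G\<close>: its value at \<open>f\<close> is the
  norm limit of the partial sums of \<open>\<Sum>n. A^n f / n!\<close>.  For bounded \<open>A\<close> the limit exists
  for every \<open>f \<in> ell2 G\<close> and is unique (by completeness and since masses are positive).\<close>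

definition ell2_exp ::
    "'v wgraph \<Rightarrow> (('v \<Rightarrow> complex) \<Rightarrow> ('v \<Rightarrow> complex)) \<Rightarrow> ('v \<Rightarrow> complex) \<Rightarrow> ('v \<Rightarrow> complex)" where
  "ell2_exp G A f =
     (THE g. ell2_tendsto G (\<lambda>N v. \<Sum>n<N. (A ^^ n) f v / fact n) g sequentially)"

definition heat :: "'v wgraph \<Rightarrow> real \<Rightarrow> ('v \<Rightarrow> complex) \<Rightarrow> ('v \<Rightarrow> complex)" where
  "heat G t = ell2_exp G (\<lambda>f x. of_real (- t) * laplacian G f x)"

text \<open>\<open>Field (Eh i)\<close> is the set of vertices incident to an edge of \<open>Eh i\<close>.\<close>

definition undirected_clusters :: "'v wgraph \<Rightarrow> 'i set \<Rightarrow> ('i \<Rightarrow> ('v \<times> 'v) set) \<Rightarrow> bool" where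
  "undirected_clusters G I Eh \<longleftrightarrow>
     countable I \<and>
     (\<forall>i\<in>I. Eh i \<subseteq> edges G \<and> Eh i \<noteq> {} \<and> sym (Eh i) \<and>
        mass G summable_on Field (Eh i) \<and>
        (\<forall>v\<in>Field (Eh i). \<forall>w\<in>Field (Eh i). (v, w) \<in> (Eh i)\<^sup>*)) \<and>
     disjoint_family_on (\<lambda>i. Field (Eh i)) I"

text \<open>Connected components of \<open>(V, F)\<close> for symmetric \<open>F\<close>, as classes of the reachability
  relation; vertices not incident to \<open>F\<close> form singleton components.\<close>

definition components :: "'v set \<Rightarrow> ('v \<times> 'v) set \<Rightarrow> 'v set set" where
  "components V F = V // (F\<^sup>* \<inter> V \<times> V)"

definition reduced_weight :: "'v wgraph \<Rightarrow> 'v set \<Rightarrow> 'v set \<Rightarrow> real" where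
  "reduced_weight G C D = (\<Sum>\<^sub>\<infinity>(v, w)\<in>C \<times> D. weight G v w)"

text \<open>The reduced graph need not be locally finite, since a component may be infinite;
  its Laplacian is nevertheless given by the same formula with convergent infinite sums.\<close>

definition reduced_graph :: "'v wgraph \<Rightarrow> ('v \<times> 'v) set \<Rightarrow> 'v set wgraph" where
  "reduced_graph G F =
     \<lparr> verts = components (verts G) F,
       mass = (\<lambda>C. \<Sum>\<^sub>\<infinity>v\<in>C. mass G v),
       edges = {(C, D). C \<in> components (verts G) F \<and> D \<in> components (verts G) F \<and>
                        reduced_weight G C D > 0},
       weight = reduced_weight G \<rparr>"

definition J_down :: "'v wgraph \<Rightarrow> ('v \<times> 'v) set \<Rightarrow> ('v \<Rightarrow> complex) \<Rightarrow> ('v set \<Rightarrow> complex)" where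
  "J_down G F f C =
     (if C \<in> verts (reduced_graph G F)
      then ell2_inner G (indicator C) f / of_real (mass (reduced_graph G F) C)
      else 0)"

definition J_up :: "'v wgraph \<Rightarrow> ('v \<times> 'v) set \<Rightarrow> ('v set \<Rightarrow> complex) \<Rightarrow> ('v \<Rightarrow> complex)" where
  "J_up G F h x = (\<Sum>\<^sub>\<infinity>C\<in>verts (reduced_graph G F). h C * indicator C x)"

end

(* The semigroup convergence is proved directly from energy estimates; neither the spectral theorem nor
   resolvents are needed.

   For a bounded, symmetric, positive operator B, differentiation of |v|^2 + 2 s <B v, v> along
   v(s) = exp(-s B) f shows 2 s <B v(s), v(s)> <= |f|^2 and |v(s)| <= |f|. For B = L_beta the quadratic
   form dominates a_beta(x, y) |v(x) - v(y)|^2, so as beta tends to infinity the flow v_beta(s) stays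
   bounded and its differences along cluster edges tend to 0. Hence v_beta(s) tends weakly to 0
   against every g in the kernel of P, where P = J_up J_down is the orthogonal projection onto the
   functions that are constant on clusters.

   If P f = 0, then |exp(-t L_beta) f|^2 = <exp(-2t L_beta) f, f> tends to 0. If P f = f, put
   u(s) = exp(-s P L P) f and w = exp(-s L_beta) f - u(s). As L_beta u = L u, the derivative of |w|^2 is at
   most -2 <exp(-s L_beta) f, (1 - P) L u(s)>, which tends to 0 pointwise and boundedly in s, and
   integration over [0, t] gives |w(t)| -> 0. Finally J_up intertwines the reduced Laplacian with P L P.

   To have Hilbert spaces as types, a function f on the vertices is represented by sqrt(m) f in the
   unweighted space l2, extended by 0 outside the vertex set. *)

theory Submission
  imports Defs
begin

section \<open>The Hilbert space of square-summable functions\<close>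

text \<open>Two obstacles shape the argument. The operators L_beta need not have a common norm
  bound, so estimates on the flow have to come from positivity alone. And the energy bound controls
  one edge at a time: clusters may be infinite, and infinite in number, so no uniform rate is
  available and only weak convergence can be read off directly. The limit generator does not see
  beta, because the diverging weights multiply differences that vanish on functions constant on
  clusters; this is the identity L_beta P = L P. P arises as 1 - K, where K is the Laplacian of a
  complete graph on each cluster C with weights m(x) m(y) / m(C). Boundedness and symmetry of P are
  thus instances of facts about Laplacians. Moreover P g = 0 reads g = K g, whence <v, g> = <grad v,
  grad g>: testing against the kernel of P involves only differences inside clusters.\<close>

typedef 'a l2 = "{f :: 'a \<Rightarrow> complex. (\<lambda>x. (cmod (f x))\<^sup>2) summable_on UNIV}"
  morphisms l2_fun Abs_l2
  by (rule exI[of _ "\<lambda>_. 0"]) simp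

setup_lifting type_definition_l2

lemma l2_fun_square_summable: "(\<lambda>x. (cmod (l2_fun f x))\<^sup>2) summable_on UNIV"
  using l2_fun[of f] by simp

lemma square_norm_add_le:
  fixes a b :: "'a::real_inner"
  shows "(norm (a + b))\<^sup>2 \<le> 2 * (norm a)\<^sup>2 + 2 * (norm b)\<^sup>2"
proof -
  have "(norm (a + b))\<^sup>2 + (norm (a - b))\<^sup>2 = 2 * (norm a)\<^sup>2 + 2 * (norm b)\<^sup>2"
    by (simp add: power2_norm_eq_inner inner_simps inner_commute)
  thus ?thesis by (smt (verit) zero_le_power2)
qed

lemma abs_inner_le_sum_squares:
  fixes a b :: "'a::real_inner"
  shows "\<bar>inner a b\<bar> \<le> ((norm a)\<^sup>2 + (norm b)\<^sup>2) / 2"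
  using Cauchy_Schwarz_ineq2[of a b] sum_squares_bound[of "norm a" "norm b"] by simp

lemma summable_inner_of_squares:
  fixes f g :: "'a \<Rightarrow> 'b::real_inner"
  assumes "(\<lambda>x. (norm (f x))\<^sup>2) summable_on A" "(\<lambda>x. (norm (g x))\<^sup>2) summable_on A"
  shows "(\<lambda>x. inner (f x) (g x)) summable_on A"
proof (rule abs_summable_summable, rule summable_on_comparison_test)
  show "(\<lambda>x. ((norm (f x))\<^sup>2 + (norm (g x))\<^sup>2) * (1/2)) summable_on A"
    by (intro summable_on_cmult_left summable_on_add assms)
qed (use abs_inner_le_sum_squares in auto)

lemma summable_square_add:
  fixes f g :: "'a \<Rightarrow> 'b::real_inner"
  assumes "(\<lambda>x. (norm (f x))\<^sup>2) summable_on A" "(\<lambda>x. (norm (g x))\<^sup>2) summable_on A"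
  shows "(\<lambda>x. (norm (f x + g x))\<^sup>2) summable_on A"
proof (rule summable_on_comparison_test)
  show "(\<lambda>x. 2 * (norm (f x))\<^sup>2 + 2 * (norm (g x))\<^sup>2) summable_on A"
    by (intro summable_on_cmult_right summable_on_add assms)
qed (use square_norm_add_le in auto)

instantiation l2 :: (type) real_vector
begin

lift_definition zero_l2 :: "'a l2" is "\<lambda>_. 0" by simp

lift_definition plus_l2 :: "'a l2 \<Rightarrow> 'a l2 \<Rightarrow> 'a l2" is "\<lambda>f g x. f x + g x"
  by (simp add: summable_square_add)

lift_definition uminus_l2 :: "'a l2 \<Rightarrow> 'a l2" is "\<lambda>f x. - f x" by simp

lift_definition minus_l2 :: "'a l2 \<Rightarrow> 'a l2 \<Rightarrow> 'a l2" is "\<lambda>f g x. f x - g x"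
  using summable_square_add[of _ _ "\<lambda>x. - g x" for g] by simp

lift_definition scaleR_l2 :: "real \<Rightarrow> 'a l2 \<Rightarrow> 'a l2" is "\<lambda>c f x. c *\<^sub>R f x"
  by (simp add: power_mult_distrib summable_on_cmult_right)

instance
  by standard (transfer; simp add: fun_eq_iff algebra_simps)+

end

text \<open>On complex values \<open>inner\<close> is the real part of the Hermitian product. The
  norm is the same, and symmetry, positivity and exponentials are only used over the reals.\<close>

instantiation l2 :: (type) real_inner
begin

lift_definition inner_l2 :: "'a l2 \<Rightarrow> 'a l2 \<Rightarrow> real" is "\<lambda>f g. \<Sum>\<^sub>\<infinity>x. inner (f x) (g x)" .

definition "norm_l2 f = sqrt (inner f (f :: 'a l2))"
definition "sgn_l2 f = (f :: 'a l2) /\<^sub>R norm f"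
definition "dist_l2 f g = norm (f - (g :: 'a l2))"
definition
  "(uniformity :: ('a l2 \<times> 'a l2) filter) = (INF e\<in>{0<..}. principal {(x, y). dist x y < e})"
definition
  "open (S :: 'a l2 set) \<longleftrightarrow> (\<forall>x\<in>S. \<forall>\<^sub>F (x', y) in uniformity. x' = x \<longrightarrow> y \<in> S)"

instance
proof
  fix f g h :: "'a l2" and r :: real
  show "inner f g = inner g f" by transfer (simp add: inner_commute)
  show "inner (f + g) h = inner f h + inner g h"
    by transfer (simp add: inner_add_left infsum_add summable_inner_of_squares)
  show "inner (r *\<^sub>R f) g = r * inner f g"
    by transfer (simp add: infsum_cmult_right')
  show "0 \<le> inner f f" by transfer (simp add: infsum_nonneg)
  show "inner f f = 0 \<longleftrightarrow> f = 0"
  proof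
    assume "inner f f = 0"
    hence "(\<Sum>\<^sub>\<infinity>x. (cmod (l2_fun f x))\<^sup>2) = 0"
      by (simp add: inner_l2.rep_eq power2_norm_eq_inner)
    hence "(cmod (l2_fun f x))\<^sup>2 = 0" for x
      by (intro nonneg_infsum_le_0D[of "\<lambda>x. (cmod (l2_fun f x))\<^sup>2" UNIV])
         (use l2_fun_square_summable in auto)
    thus "f = 0" by (intro l2_fun_inject[THEN iffD1]) (auto simp: zero_l2.rep_eq)
  qed (simp add: inner_l2.rep_eq zero_l2.rep_eq)
qed (simp_all add: norm_l2_def sgn_l2_def dist_l2_def uniformity_l2_def open_l2_def)

end

lemma l2_eqI: "(\<And>x. l2_fun f x = l2_fun g x) \<Longrightarrow> f = g"
  by (simp add: l2_fun_inject[symmetric] fun_eq_iff)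

lemma inner_l2_has_sum: "((\<lambda>x. inner (l2_fun f x) (l2_fun g x)) has_sum inner f g) UNIV"
  by (simp add: inner_l2.rep_eq summable_inner_of_squares l2_fun_square_summable)

lemma norm_l2_has_sum: "((\<lambda>x. (cmod (l2_fun f x))\<^sup>2) has_sum (norm f)\<^sup>2) UNIV"
  using inner_l2_has_sum[of f f] by (simp add: power2_norm_eq_inner)

lemma sum_le_norm_l2:
  "finite F \<Longrightarrow> (\<Sum>x\<in>F. (cmod (l2_fun f x))\<^sup>2) \<le> (norm f)\<^sup>2"
  using finite_sum_le_has_sum[OF norm_l2_has_sum[of f], of F] by simp

lemma l2_fun_le_norm: "cmod (l2_fun f x) \<le> norm f"
  using sum_le_norm_l2[of "{x}" f] by (simp add: power2_le_iff_abs_le)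

lemma square_summable_of_bounded_sums:
  assumes "\<And>F. finite F \<Longrightarrow> (\<Sum>x\<in>F. (cmod (f x))\<^sup>2) \<le> M"
  shows "(\<lambda>x. (cmod (f x))\<^sup>2) summable_on UNIV"
  by (rule nonneg_bdd_above_summable_on) (auto intro!: bdd_aboveI[of _ M] assms)

lemma norm_l2_le:
  assumes "\<And>F. finite F \<Longrightarrow> (\<Sum>x\<in>F. (cmod (l2_fun f x))\<^sup>2) \<le> M\<^sup>2" "0 \<le> M"
  shows "norm f \<le> M"
proof -
  have "(norm f)\<^sup>2 \<le> M\<^sup>2"
    by (rule has_sum_le_finite_sums[OF norm_l2_has_sum]) (use assms in auto)
  thus ?thesis using assms(2) power2_le_imp_le by blast
qed

text \<open>Coordinates are dominated by the norm, so a Cauchy sequence converges pointwise; the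
  Cauchy estimate passes to the limit on each finite set of coordinates, which yields square
  summability of the limit and norm convergence.\<close>

instance l2 :: (type) complete_space
proof
  fix X :: "nat \<Rightarrow> 'a l2" assume X: "Cauchy X"
  have "Cauchy (\<lambda>n. l2_fun (X n) x)" for x
  proof (rule metric_CauchyI)
    fix e :: real assume "0 < e"
    then obtain N where N: "\<And>m n. m \<ge> N \<Longrightarrow> n \<ge> N \<Longrightarrow> norm (X m - X n) < e"
      using X unfolding Cauchy_def dist_norm by blast
    have "dist (l2_fun (X m) x) (l2_fun (X n) x) < e" if "m \<ge> N" "n \<ge> N" for m n
      using l2_fun_le_norm[of "X m - X n" x] N[OF that] by (simp add: dist_norm minus_l2.rep_eq)
    thus "\<exists>N. \<forall>m\<ge>N. \<forall>n\<ge>N. dist (l2_fun (X m) x) (l2_fun (X n) x) < e" by blast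
  qed
  hence "\<forall>x. \<exists>l. (\<lambda>n. l2_fun (X n) x) \<longlonglongrightarrow> l" using Cauchy_convergent convergent_def by blast
  then obtain f where f: "\<And>x. (\<lambda>n. l2_fun (X n) x) \<longlonglongrightarrow> f x" by metis
  \<comment> \<open>Finite sums only: \<open>f\<close> is not yet known to be square summable, and
    on a finite set the limit in \<open>m\<close> is termwise.\<close>
  have tail: "\<exists>N. \<forall>n\<ge>N. \<forall>F. finite F \<longrightarrow> (\<Sum>x\<in>F. (cmod (f x - l2_fun (X n) x))\<^sup>2) \<le> e\<^sup>2" if e: "0 < e" for e :: real
  proof -
    obtain N where N: "\<And>m n. m \<ge> N \<Longrightarrow> n \<ge> N \<Longrightarrow> norm (X m - X n) < e"
      using X e unfolding Cauchy_def dist_norm by blast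
    have "(\<Sum>x\<in>F. (cmod (f x - l2_fun (X n) x))\<^sup>2) \<le> e\<^sup>2" if "n \<ge> N" "finite F" for n F
    proof (rule tendsto_upperbound)
      show "(\<lambda>m. \<Sum>x\<in>F. (cmod (l2_fun (X m) x - l2_fun (X n) x))\<^sup>2)
              \<longlonglongrightarrow> (\<Sum>x\<in>F. (cmod (f x - l2_fun (X n) x))\<^sup>2)"
        by (intro tendsto_intros f)
      have "(\<Sum>x\<in>F. (cmod (l2_fun (X m) x - l2_fun (X n) x))\<^sup>2) \<le> e\<^sup>2" if "m \<ge> N" for m
      proof -
        have "(norm (X m - X n))\<^sup>2 \<le> e\<^sup>2"
          using N[OF that \<open>n \<ge> N\<close>] by (intro power_mono) auto
        thus ?thesis using sum_le_norm_l2[OF \<open>finite F\<close>, of "X m - X n"]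
          by (simp add: minus_l2.rep_eq)
      qed
      thus "\<forall>\<^sub>F m in sequentially. (\<Sum>x\<in>F. (cmod (l2_fun (X m) x - l2_fun (X n) x))\<^sup>2) \<le> e\<^sup>2"
        using eventually_sequentially by blast
    qed simp
    thus ?thesis by blast
  qed
  obtain N where "\<And>F. finite F \<Longrightarrow> (\<Sum>x\<in>F. (cmod (f x - l2_fun (X N) x))\<^sup>2) \<le> 1\<^sup>2"
    using tail[of 1] by auto
  hence "(\<lambda>x. (cmod (f x - l2_fun (X N) x))\<^sup>2) summable_on UNIV"
    by (rule square_summable_of_bounded_sums)
  from summable_square_add[OF this l2_fun_square_summable[of "X N"]]
  have "(\<lambda>x. (cmod (f x))\<^sup>2) summable_on UNIV" by simp
  hence rep: "l2_fun (Abs_l2 f) = f" by (simp add: Abs_l2_inverse)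
  have "X \<longlonglongrightarrow> Abs_l2 f"
  proof (rule LIMSEQ_I)
    fix e :: real assume "0 < e"
    then obtain N where
      N: "\<And>n F. n \<ge> N \<Longrightarrow> finite F \<Longrightarrow> (\<Sum>x\<in>F. (cmod (f x - l2_fun (X n) x))\<^sup>2) \<le> (e/2)\<^sup>2"
      using tail[of "e/2"] by auto
    have "norm (Abs_l2 f - X n) \<le> e/2" if "n \<ge> N" for n
      by (rule norm_l2_le) (use N[OF that] \<open>0 < e\<close> in \<open>auto simp: minus_l2.rep_eq rep\<close>)
    thus "\<exists>N. \<forall>n\<ge>N. norm (X n - Abs_l2 f) < e"
      using \<open>0 < e\<close> by (intro exI[of _ N]) (fastforce simp: norm_minus_commute)
  qed
  thus "convergent X" by (auto simp: convergent_def)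
qed

instance l2 :: (type) banach ..

text \<open>The operator algebra requires this: on the zero space the identity would have norm 0.
  Types are inhabited, so a unit vector at some index \<open>x0\<close> exists.\<close>

instance l2 :: (type) perfect_space
proof
  fix f :: "'a l2"
  obtain x0 :: 'a where True by simp
  define d :: "'a l2" where "d = Abs_l2 (\<lambda>x. if x = x0 then 1 else 0)"
  have "(\<lambda>x :: 'a. (cmod (if x = x0 then 1 else 0))\<^sup>2) summable_on UNIV"
    by (rule finite_nonzero_values_imp_summable_on, rule finite_subset[of _ "{x0}"])
       (auto split: if_splits)
  hence "l2_fun d x0 = 1" unfolding d_def by (subst Abs_l2_inverse) simp_all
  hence d: "d \<noteq> 0" by (auto simp: zero_l2.rep_eq)
  show "\<not> open {f}"
  proof
    assume "open {f}"
    then obtain e where e: "e > 0" "\<And>g. dist g f < e \<Longrightarrow> g = f"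
      unfolding open_dist by auto
    have "dist (f + (e / 2 / norm d) *\<^sub>R d) f < e" using e(1) d by (simp add: dist_norm)
    from e(2)[OF this] have "(e / 2 / norm d) *\<^sub>R d = 0" by simp
    thus False using e(1) d by simp
  qed
qed


section \<open>The Banach algebra of bounded endomorphisms\<close>

text \<open>Bounded operators under composition form a unital Banach algebra; as a type of that
  class they inherit \<open>exp\<close> with its series and derivative.\<close>

typedef (overloaded) 'a endo = "UNIV :: ('a::real_normed_vector \<Rightarrow>\<^sub>L 'a) set"
  morphisms endo_blinfun Endo by auto

setup_lifting type_definition_endo

instantiation endo :: (real_normed_vector) real_vector
begin

lift_definition zero_endo :: "'a endo" is 0 .
lift_definition plus_endo :: "'a endo \<Rightarrow> 'a endo \<Rightarrow> 'a endo" is "(+)" .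
lift_definition minus_endo :: "'a endo \<Rightarrow> 'a endo \<Rightarrow> 'a endo" is "(-)" .
lift_definition uminus_endo :: "'a endo \<Rightarrow> 'a endo" is uminus .
lift_definition scaleR_endo :: "real \<Rightarrow> 'a endo \<Rightarrow> 'a endo" is scaleR .

instance
  by standard (transfer; simp add: algebra_simps)+

end

instantiation endo :: ("{real_normed_vector, perfect_space}") real_normed_algebra_1
begin

lift_definition one_endo :: "'a endo" is id_blinfun .
lift_definition times_endo :: "'a endo \<Rightarrow> 'a endo \<Rightarrow> 'a endo" is blinfun_compose .
lift_definition norm_endo :: "'a endo \<Rightarrow> real" is norm .
definition "sgn_endo A = (A :: 'a endo) /\<^sub>R norm A"
definition "dist_endo A B = norm (A - (B :: 'a endo))"
definition
  "(uniformity :: ('a endo \<times> 'a endo) filter) = (INF e\<in>{0<..}. principal {(x, y). dist x y < e})"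
definition
  "open (S :: 'a endo set) \<longleftrightarrow> (\<forall>x\<in>S. \<forall>\<^sub>F (x', y) in uniformity. x' = x \<longrightarrow> y \<in> S)"

instance
proof
  fix A B C :: "'a endo" and r s :: real
  show "A * B * C = A * (B * C)" by transfer (simp add: blinfun_eqI)
  show "1 * A = A" "A * 1 = A" by (transfer; simp add: blinfun_eqI)+
  show "(A + B) * C = A * C + B * C" "A * (B + C) = A * B + A * C"
    by (transfer; simp add: blinfun_eqI blinfun.bilinear_simps)+
  show "(r *\<^sub>R A) * B = r *\<^sub>R (A * B)" "A * (r *\<^sub>R B) = r *\<^sub>R (A * B)"
    by (transfer; simp add: blinfun_eqI blinfun.bilinear_simps)+
  show "norm A = 0 \<longleftrightarrow> A = 0" "norm (A + B) \<le> norm A + norm B" "norm (r *\<^sub>R A) = \<bar>r\<bar> * norm A"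
    by (transfer; simp add: norm_triangle_ineq)+
  show "norm (A * B) \<le> norm A * norm B" by transfer (rule norm_blinfun_compose)
  show "norm (1 :: 'a endo) = 1" by transfer simp
  have "norm (1 :: 'a endo) \<noteq> norm (0 :: 'a endo)" by transfer simp
  thus "(0 :: 'a endo) \<noteq> 1" by auto
qed (simp_all add: sgn_endo_def dist_endo_def uniformity_endo_def open_endo_def)

end

instance endo :: ("{banach, perfect_space}") banach
proof
  fix X :: "nat \<Rightarrow> 'a endo" assume "Cauchy X"
  hence "Cauchy (\<lambda>n. endo_blinfun (X n))"
    unfolding Cauchy_def dist_norm norm_endo.rep_eq minus_endo.rep_eq by simp
  then obtain L where "(\<lambda>n. endo_blinfun (X n)) \<longlonglongrightarrow> L"
    using Cauchy_convergent convergent_def by blast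
  hence "X \<longlonglongrightarrow> Endo L"
    by (simp add: tendsto_iff dist_norm norm_endo.rep_eq minus_endo.rep_eq Endo_inverse)
  thus "convergent X" by (auto simp: convergent_def)
qed

lift_definition endo_apply :: "'a::real_normed_vector endo \<Rightarrow> 'a \<Rightarrow> 'a" (infixl "\<bullet>\<^sub>e" 71) is blinfun_apply .

lemma bounded_bilinear_endo_apply:
  "bounded_bilinear (endo_apply :: 'a::{real_normed_vector, perfect_space} endo \<Rightarrow> _)"
proof
  show "\<exists>K. \<forall>A (x :: 'a). norm (A \<bullet>\<^sub>e x) \<le> norm A * norm x * K"
    by (rule exI[of _ 1], transfer) (simp add: norm_blinfun)
qed (transfer; simp add: blinfun.bilinear_simps)+

interpretation endo: bounded_bilinear "endo_apply :: 'a::{real_normed_vector, perfect_space} endo \<Rightarrow> _"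
  by (rule bounded_bilinear_endo_apply)

lemma endo_apply_one [simp]: "1 \<bullet>\<^sub>e x = x"
  and endo_apply_mult: "(A * B) \<bullet>\<^sub>e x = A \<bullet>\<^sub>e (B \<bullet>\<^sub>e x)"
  by (transfer; simp)+

lemma endo_eqI: "(\<And>x. A \<bullet>\<^sub>e x = B \<bullet>\<^sub>e x) \<Longrightarrow> A = B"
  by transfer (simp add: blinfun_eqI)

section \<open>Semigroups of positive symmetric operators\<close>

definition symmetric_endo :: "'a::{real_inner, perfect_space} endo \<Rightarrow> bool" where
  "symmetric_endo A \<longleftrightarrow> (\<forall>x y. inner (A \<bullet>\<^sub>e x) y = inner x (A \<bullet>\<^sub>e y))"

text \<open>Commutation passes to powers and so to the series. It serves to keep the compressed
  semigroup inside the range of the projection.\<close>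

lemma exp_commute_of_commute:
  fixes A B :: "'a::{real_normed_algebra_1, banach}"
  assumes "A * B = B * A"
  shows "exp A * B = B * exp A"
proof -
  have *: "A ^ n * B = B * A ^ n" for n
    by (induction n) (simp_all add: assms mult.assoc flip: power_Suc2, simp add: mult.assoc[symmetric] assms power_Suc2)
  have "(\<lambda>n. (A ^ n /\<^sub>R fact n) * B) sums (exp A * B)"
    by (intro sums_mult2 exp_converges)
  moreover have "(\<lambda>n. B * (A ^ n /\<^sub>R fact n)) sums (B * exp A)"
    by (intro sums_mult exp_converges)
  ultimately show ?thesis using sums_unique2 by (simp add: *)
qed

lemma exp_endo_sums:
  fixes A :: "'a::{banach, perfect_space} endo"
  shows "(\<lambda>n. (A ^ n \<bullet>\<^sub>e x) /\<^sub>R fact n) sums (exp A \<bullet>\<^sub>e x)"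
  using bounded_linear.sums[OF endo.bounded_linear_left exp_converges[of A], of x]
  by (simp add: endo.scaleR_left)

lemma symmetric_endo_exp:
  fixes A :: "'a::{real_inner, banach, perfect_space} endo"
  assumes "symmetric_endo A"
  shows "symmetric_endo (exp A)"
  unfolding symmetric_endo_def
proof (intro allI)
  fix x y
  have *: "inner (A ^ n \<bullet>\<^sub>e x) y = inner x (A ^ n \<bullet>\<^sub>e y)" for n
  proof (induction n arbitrary: x)
    case (Suc n)
    have "inner (A ^ Suc n \<bullet>\<^sub>e x) y = inner (A ^ n \<bullet>\<^sub>e (A \<bullet>\<^sub>e x)) y"
      by (simp add: power_Suc2 endo_apply_mult del: power_Suc)
    also have "\<dots> = inner x (A ^ Suc n \<bullet>\<^sub>e y)"
      using assms by (simp add: Suc symmetric_endo_def endo_apply_mult)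
    finally show ?case .
  qed simp
  have "(\<lambda>n. inner ((A ^ n \<bullet>\<^sub>e x) /\<^sub>R fact n) y) sums inner (exp A \<bullet>\<^sub>e x) y"
    by (intro bounded_linear.sums[OF bounded_linear_inner_left] exp_endo_sums)
  moreover have "(\<lambda>n. inner x ((A ^ n \<bullet>\<^sub>e y) /\<^sub>R fact n)) sums inner x (exp A \<bullet>\<^sub>e y)"
    by (intro bounded_linear.sums[OF bounded_linear_inner_right] exp_endo_sums)
  ultimately show "inner (exp A \<bullet>\<^sub>e x) y = inner x (exp A \<bullet>\<^sub>e y)"
    using sums_unique2 by (simp add: *)
qed

section \<open>The semigroup exp(-tA) and its energy estimate\<close>

definition semigroup_exp :: "'a::{real_inner, banach, perfect_space} endo \<Rightarrow> real \<Rightarrow> 'a endo" where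
  "semigroup_exp A t = exp (t *\<^sub>R (- A))"

lemma semigroup_exp_0 [simp]: "semigroup_exp A 0 = 1"
  by (simp add: semigroup_exp_def)

lemma semigroup_exp_add: "semigroup_exp A (s + t) = semigroup_exp A s * semigroup_exp A t"
  unfolding semigroup_exp_def scaleR_left_distrib
  by (rule exp_add_commuting) simp

lemma symmetric_semigroup_exp:
  assumes "symmetric_endo A"
  shows "symmetric_endo (semigroup_exp A t)"
  unfolding semigroup_exp_def
  by (rule symmetric_endo_exp)
     (use assms in \<open>simp add: symmetric_endo_def endo.scaleR_left endo.minus_left\<close>)

lemma semigroup_exp_has_vector_derivative:
  "((\<lambda>s. semigroup_exp A s \<bullet>\<^sub>e x) has_vector_derivative - (A \<bullet>\<^sub>e (semigroup_exp A s \<bullet>\<^sub>e x)))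
     (at s within T)"
proof -
  have "((\<lambda>s. exp (s *\<^sub>R (- A)) \<bullet>\<^sub>e x) has_vector_derivative
          ((exp (s *\<^sub>R (- A)) * (- A)) \<bullet>\<^sub>e x)) (at s within T)"
    by (intro bounded_linear.has_vector_derivative[OF endo.bounded_linear_left]
          exp_scaleR_has_vector_derivative_right)
  also have "exp (s *\<^sub>R (- A)) * (- A) = (- A) * exp (s *\<^sub>R (- A))"
    by (rule exp_times_scaleR_commute)
  finally show ?thesis
    by (simp add: semigroup_exp_def endo_apply_mult endo.minus_left)
qed

lemma has_real_derivative_inner:
  fixes u v :: "real \<Rightarrow> 'a::real_inner"
  assumes "(u has_vector_derivative u') (at s within T)" "(v has_vector_derivative v') (at s within T)"
  shows "((\<lambda>s. inner (u s) (v s)) has_real_derivative inner (u s) v' + inner u' (v s)) (at s within T)"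
  using bounded_bilinear.has_vector_derivative[OF bounded_bilinear_inner assms]
  by (simp add: has_real_derivative_iff_has_vector_derivative)

text \<open>The factor \<open>2 * s\<close> makes the first-order terms cancel: the squared norm has
  derivative -2 <A v, v>, the other summand 2 <A v, v> - 4 s |A v|^2. The resulting energy bound
  |x|^2 / (2 t) does not depend on the norm of \<open>A\<close>.\<close>

lemma semigroup_exp_energy:
  assumes sym: "symmetric_endo A" and pos: "\<And>x. 0 \<le> inner (A \<bullet>\<^sub>e x) x" and "0 \<le> t"
  shows "(norm (semigroup_exp A t \<bullet>\<^sub>e x))\<^sup>2
           + 2 * t * inner (A \<bullet>\<^sub>e (semigroup_exp A t \<bullet>\<^sub>e x)) (semigroup_exp A t \<bullet>\<^sub>e x) \<le> (norm x)\<^sup>2"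
proof -
  define v where "v s = semigroup_exp A s \<bullet>\<^sub>e x" for s
  define \<phi> where "\<phi> s = inner (v s) (v s) + 2 * s * inner (A \<bullet>\<^sub>e v s) (v s)" for s
  have v: "(v has_vector_derivative - (A \<bullet>\<^sub>e v s)) (at s)" for s
    unfolding v_def by (rule semigroup_exp_has_vector_derivative)
  have Av: "((\<lambda>s. A \<bullet>\<^sub>e v s) has_vector_derivative A \<bullet>\<^sub>e (- (A \<bullet>\<^sub>e v s))) (at s)" for s
    by (intro bounded_linear.has_vector_derivative[OF endo.bounded_linear_right] v)
  have "DERIV \<phi> s :> - 4 * s * (norm (A \<bullet>\<^sub>e v s))\<^sup>2" for s
  proof -
    have "DERIV \<phi> s :> (inner (v s) (- (A \<bullet>\<^sub>e v s)) + inner (- (A \<bullet>\<^sub>e v s)) (v s))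
      + (2 * inner (A \<bullet>\<^sub>e v s) (v s)
         + (inner (A \<bullet>\<^sub>e v s) (- (A \<bullet>\<^sub>e v s)) + inner (A \<bullet>\<^sub>e (- (A \<bullet>\<^sub>e v s))) (v s)) * (2 * s))"
      unfolding \<phi>_def
      by (intro DERIV_add DERIV_mult has_real_derivative_inner v Av)
         (auto intro!: derivative_eq_intros)
    moreover have "inner (A \<bullet>\<^sub>e (A \<bullet>\<^sub>e v s)) (v s) = inner (A \<bullet>\<^sub>e v s) (A \<bullet>\<^sub>e v s)"
      using sym unfolding symmetric_endo_def by metis
    ultimately show ?thesis
      by (simp add: endo.minus_right inner_commute power2_norm_eq_inner algebra_simps)
  qed
  hence "\<phi> t \<le> \<phi> 0"
    by (intro DERIV_nonpos_imp_nonincreasing[OF \<open>0 \<le> t\<close>]) (force simp: mult_nonneg_nonneg)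
  thus ?thesis by (simp add: \<phi>_def v_def power2_norm_eq_inner)
qed

lemma semigroup_exp_contraction:
  assumes "symmetric_endo A" and "\<And>x. 0 \<le> inner (A \<bullet>\<^sub>e x) x" and "0 \<le> t"
  shows "norm (semigroup_exp A t \<bullet>\<^sub>e x) \<le> norm x"
proof -
  have "0 \<le> 2 * t * inner (A \<bullet>\<^sub>e (semigroup_exp A t \<bullet>\<^sub>e x)) (semigroup_exp A t \<bullet>\<^sub>e x)"
    using assms by simp
  hence "(norm (semigroup_exp A t \<bullet>\<^sub>e x))\<^sup>2 \<le> (norm x)\<^sup>2"
    using semigroup_exp_energy[OF assms, of x] by linarith
  thus ?thesis by (simp add: power2_le_iff_abs_le)
qed

lemma continuous_on_semigroup_exp: "continuous_on T (\<lambda>s. semigroup_exp A s \<bullet>\<^sub>e x)"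
  by (rule continuous_on_vector_derivative) (rule semigroup_exp_has_vector_derivative)

text \<open>By \<open>symP\<close> and \<open>idem\<close>, \<open>P\<close> is an orthogonal
  projection. \<open>BP\<close> says that the \<beta>-dependence of the generator disappears on its
  range, and \<open>weak\<close> is all that is kept of the divergence of the weights, so that no
  graph enters here.\<close>

theorem semigroup_exp_tendsto_compression:
  fixes B :: "real \<Rightarrow> 'a::{real_inner, banach, perfect_space} endo" and A P :: "'a endo"
  assumes sym: "\<And>\<beta>. symmetric_endo (B \<beta>)" and pos: "\<And>\<beta> x. 0 \<le> inner (B \<beta> \<bullet>\<^sub>e x) x"
    and symP: "symmetric_endo P" and idem: "P * P = P"
    and BP: "\<And>\<beta>. B \<beta> * P = A * P"
    and weak: "\<And>v g M. (\<And>\<beta>. norm (v \<beta>) \<le> M) \<Longrightarrow> (\<And>\<beta>. inner (B \<beta> \<bullet>\<^sub>e v \<beta>) (v \<beta>) \<le> M)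
                 \<Longrightarrow> P \<bullet>\<^sub>e g = 0 \<Longrightarrow> ((\<lambda>\<beta>. inner (v \<beta>) g) \<longlongrightarrow> 0) at_top"
    and t: "0 < t"
  shows "((\<lambda>\<beta>. semigroup_exp (B \<beta>) t \<bullet>\<^sub>e f) \<longlongrightarrow> semigroup_exp (P * A * P) t \<bullet>\<^sub>e (P \<bullet>\<^sub>e f)) at_top"
proof -
  define E where "E \<beta> s = semigroup_exp (B \<beta>) s" for \<beta> s
  have contr: "norm (E \<beta> s \<bullet>\<^sub>e x) \<le> norm x" if "0 \<le> s" for \<beta> s x
    unfolding E_def by (rule semigroup_exp_contraction[OF sym pos that])
  have flow_weak: "((\<lambda>\<beta>. inner (E \<beta> s \<bullet>\<^sub>e x) g) \<longlongrightarrow> 0) at_top"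
    if s: "0 < s" and g: "P \<bullet>\<^sub>e g = 0" for s x g
  proof (rule weak[OF _ _ g])
    fix \<beta>
    \<comment> \<open>\<open>weak\<close> asks for one constant bounding norm and energy, hence the
      sum of the two bounds.\<close>
    show "norm (E \<beta> s \<bullet>\<^sub>e x) \<le> norm x + (norm x)\<^sup>2 / (2 * s)"
      using contr[of s \<beta> x] s by (simp add: add_increasing2)
    have "(norm (E \<beta> s \<bullet>\<^sub>e x))\<^sup>2 + 2 * s * inner (B \<beta> \<bullet>\<^sub>e (E \<beta> s \<bullet>\<^sub>e x)) (E \<beta> s \<bullet>\<^sub>e x) \<le> (norm x)\<^sup>2"
      unfolding E_def using semigroup_exp_energy[OF sym pos] s by simp
    hence "2 * s * inner (B \<beta> \<bullet>\<^sub>e (E \<beta> s \<bullet>\<^sub>e x)) (E \<beta> s \<bullet>\<^sub>e x) \<le> (norm x)\<^sup>2"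
      using zero_le_power2[of "norm (E \<beta> s \<bullet>\<^sub>e x)"] by linarith
    hence "inner (B \<beta> \<bullet>\<^sub>e (E \<beta> s \<bullet>\<^sub>e x)) (E \<beta> s \<bullet>\<^sub>e x) \<le> (norm x)\<^sup>2 / (2 * s)"
      using s by (simp add: field_simps)
    thus "inner (B \<beta> \<bullet>\<^sub>e (E \<beta> s \<bullet>\<^sub>e x)) (E \<beta> s \<bullet>\<^sub>e x) \<le> norm x + (norm x)\<^sup>2 / (2 * s)"
      by (simp add: add_increasing)
  qed
  have ker: "((\<lambda>\<beta>. E \<beta> t \<bullet>\<^sub>e k) \<longlongrightarrow> 0) at_top" if k: "P \<bullet>\<^sub>e k = 0" for k
  proof -
    have "(norm (E \<beta> t \<bullet>\<^sub>e k))\<^sup>2 = inner (E \<beta> (t + t) \<bullet>\<^sub>e k) k" for \<beta>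
      using symmetric_semigroup_exp[OF sym, of \<beta> t] unfolding symmetric_endo_def
      by (metis E_def power2_norm_eq_inner semigroup_exp_add endo_apply_mult inner_commute)
    hence "((\<lambda>\<beta>. (norm (E \<beta> t \<bullet>\<^sub>e k))\<^sup>2) \<longlongrightarrow> 0) at_top"
      using flow_weak[of "t + t" k k] t k by simp
    hence "((\<lambda>\<beta>. norm (E \<beta> t \<bullet>\<^sub>e k)) \<longlongrightarrow> 0) at_top"
      using tendsto_real_sqrt[of "\<lambda>\<beta>. (norm (E \<beta> t \<bullet>\<^sub>e k))\<^sup>2" 0 at_top] by simp
    thus ?thesis using tendsto_norm_zero_iff by blast
  qed
  have ran: "((\<lambda>\<beta>. E \<beta> t \<bullet>\<^sub>e h) \<longlongrightarrow> semigroup_exp (P * A * P) t \<bullet>\<^sub>e h) at_top"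
    if h: "P \<bullet>\<^sub>e h = h" for h
  proof -
    define D where "D = P * A * P"
    define u where "u s = semigroup_exp D s \<bullet>\<^sub>e h" for s
    define g where "g s = A \<bullet>\<^sub>e u s - P \<bullet>\<^sub>e (A \<bullet>\<^sub>e u s)" for s
    define w where "w \<beta> s = E \<beta> s \<bullet>\<^sub>e h - u s" for \<beta> s
    \<comment> \<open>Both products equal \<open>D\<close>; hence the flow of \<open>D\<close> never
      leaves the range of \<open>P\<close>.\<close>
    have "D * P = P * D" unfolding D_def by (metis idem mult.assoc)
    hence "semigroup_exp D s * P = P * semigroup_exp D s" for s
      unfolding semigroup_exp_def by (intro exp_commute_of_commute) simp
    hence Pu: "P \<bullet>\<^sub>e u s = u s" for s
      unfolding u_def by (metis endo_apply_mult h)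
    have Pg: "P \<bullet>\<^sub>e g s = 0" for s
      unfolding g_def by (simp add: endo.diff_right idem flip: endo_apply_mult mult.assoc)
    \<comment> \<open>\<open>u s\<close> is in the range of the symmetric \<open>P\<close>,
      \<open>g s\<close> in its kernel. This lets the full flow replace \<open>w\<close> in the
      error term, and it settles time 0 below.\<close>
    have ug: "inner (u s) (g s) = 0" for s
      using symP Pu[of s] Pg[of s] unfolding symmetric_endo_def by (metis inner_zero_right)
    have Bu: "B \<beta> \<bullet>\<^sub>e u s = A \<bullet>\<^sub>e u s" for \<beta> s
      by (metis BP Pu endo_apply_mult)
    have Du: "D \<bullet>\<^sub>e u s = P \<bullet>\<^sub>e (A \<bullet>\<^sub>e u s)" for s
      unfolding D_def by (simp add: endo_apply_mult Pu)
    have w: "(w \<beta> has_vector_derivative - (B \<beta> \<bullet>\<^sub>e w \<beta> s) - g s) (at s within T)" for \<beta> s T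
    proof -
      have "(w \<beta> has_vector_derivative - (B \<beta> \<bullet>\<^sub>e (E \<beta> s \<bullet>\<^sub>e h)) - - (D \<bullet>\<^sub>e u s)) (at s within T)"
        unfolding w_def E_def u_def
        by (intro has_vector_derivative_diff semigroup_exp_has_vector_derivative)
      thus ?thesis by (simp add: Du w_def endo.diff_right Bu g_def)
    qed
    have cu: "continuous_on T u" and cE: "continuous_on T (\<lambda>s. E \<beta> s \<bullet>\<^sub>e h)" for T \<beta>
      unfolding u_def E_def by (rule continuous_on_semigroup_exp)+
    have cg: "continuous_on T g" for T
      unfolding g_def
      by (intro continuous_intros linear_continuous_on_compose[OF _ endo.bounded_linear_right[THEN bounded_linear.linear]]
         bounded_linear.continuous_on[OF endo.bounded_linear_right] cu)
    have bound: "(norm (w \<beta> t))\<^sup>2 \<le> integral {0..t} (\<lambda>s. 2 * \<bar>inner (E \<beta> s \<bullet>\<^sub>e h) (g s)\<bar>)" for \<beta>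
    proof -
      define F' where "F' s = inner (w \<beta> s) (- (B \<beta> \<bullet>\<^sub>e w \<beta> s) - g s)
          + inner (- (B \<beta> \<bullet>\<^sub>e w \<beta> s) - g s) (w \<beta> s)" for s
      have 1: "(F' has_integral inner (w \<beta> t) (w \<beta> t) - inner (w \<beta> 0) (w \<beta> 0)) {0..t}"
        unfolding F'_def
        by (rule fundamental_theorem_of_calculus)
           (use t in \<open>auto simp flip: has_real_derivative_iff_has_vector_derivative
              intro!: has_real_derivative_inner w\<close>)
      have 2: "((\<lambda>s. 2 * \<bar>inner (E \<beta> s \<bullet>\<^sub>e h) (g s)\<bar>) has_integral
          integral {0..t} (\<lambda>s. 2 * \<bar>inner (E \<beta> s \<bullet>\<^sub>e h) (g s)\<bar>)) {0..t}"
        by (intro integrable_integral integrable_continuous_real continuous_intros cE cg)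
      have "F' s \<le> 2 * \<bar>inner (E \<beta> s \<bullet>\<^sub>e h) (g s)\<bar>" for s
      proof -
        have "F' s = - 2 * inner (B \<beta> \<bullet>\<^sub>e w \<beta> s) (w \<beta> s) - 2 * inner (w \<beta> s) (g s)"
          unfolding F'_def by (simp add: inner_diff_right inner_diff_left inner_commute)
        moreover have "inner (w \<beta> s) (g s) = inner (E \<beta> s \<bullet>\<^sub>e h) (g s)"
          by (simp add: w_def inner_diff_left ug)
        ultimately show ?thesis using pos[of \<beta> "w \<beta> s"] by linarith
      qed
      from has_integral_le[OF 1 2 this]
      show ?thesis by (simp add: w_def E_def u_def power2_norm_eq_inner)
    qed
    have "((\<lambda>\<beta>. integral {0..t} (\<lambda>s. 2 * \<bar>inner (E \<beta> s \<bullet>\<^sub>e h) (g s)\<bar>)) \<longlongrightarrow> 0) at_top"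
    \<comment> \<open>Dominated convergence speaks of sequences, so the limit is tested along
      arbitrary \<open>X\<close> tending to infinity; contractivity supplies a majorant free of
      \<beta>.\<close>
    proof (rule tendsto_at_topI_sequentially)
      fix X :: "nat \<Rightarrow> real" assume X: "filterlim X at_top sequentially"
      have "(\<lambda>n. integral {0..t} (\<lambda>s. 2 * \<bar>inner (E (X n) s \<bullet>\<^sub>e h) (g s)\<bar>))
             \<longlonglongrightarrow> integral {0..t} (\<lambda>s. 0 :: real)"
      proof (rule dominated_convergence)
        show "(\<lambda>s. 2 * \<bar>inner (E (X n) s \<bullet>\<^sub>e h) (g s)\<bar>) integrable_on {0..t}" for n
          by (intro integrable_continuous_real continuous_intros cE cg)
        show "(\<lambda>s. 2 * (norm h * norm (g s))) integrable_on {0..t}"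
          by (intro integrable_continuous_real continuous_intros cg)
        show "norm (2 * \<bar>inner (E (X n) s \<bullet>\<^sub>e h) (g s)\<bar>) \<le> 2 * (norm h * norm (g s))"
          if "s \<in> {0..t}" for n s
        proof -
          have "\<bar>inner (E (X n) s \<bullet>\<^sub>e h) (g s)\<bar> \<le> norm (E (X n) s \<bullet>\<^sub>e h) * norm (g s)"
            by (rule Cauchy_Schwarz_ineq2)
          also have "\<dots> \<le> norm h * norm (g s)"
            using contr[of s "X n" h] that by (intro mult_right_mono) auto
          finally show ?thesis by simp
        qed
        show "(\<lambda>n. 2 * \<bar>inner (E (X n) s \<bullet>\<^sub>e h) (g s)\<bar>) \<longlonglongrightarrow> 0" if "s \<in> {0..t}" for s
        \<comment> \<open>\<open>flow_weak\<close> needs positive time, as the energy bound is of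
          order 1/s; at time 0 the inner product is <h, g 0>, which is exactly 0.\<close>
        proof (cases "s = 0")
          case True
          have "u 0 = h" by (simp add: u_def)
          with True ug[of 0] show ?thesis by (simp add: E_def)
        next
          case False
          hence "((\<lambda>\<beta>. 2 * \<bar>inner (E \<beta> s \<bullet>\<^sub>e h) (g s)\<bar>) \<longlongrightarrow> 2 * \<bar>0\<bar>) at_top"
            using that by (intro tendsto_intros flow_weak Pg) auto
          from filterlim_compose[OF this X] show ?thesis by simp
        qed
      qed
      thus "(\<lambda>n. integral {0..t} (\<lambda>s. 2 * \<bar>inner (E (X n) s \<bullet>\<^sub>e h) (g s)\<bar>)) \<longlonglongrightarrow> 0" by simp
    qed
    hence "((\<lambda>\<beta>. (norm (w \<beta> t))\<^sup>2) \<longlongrightarrow> 0) at_top"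
      by (rule Lim_null_comparison[rotated]) (use bound in simp)
    hence "((\<lambda>\<beta>. norm (w \<beta> t)) \<longlongrightarrow> 0) at_top"
      using tendsto_real_sqrt[of "\<lambda>\<beta>. (norm (w \<beta> t))\<^sup>2" 0 at_top] by simp
    hence "((\<lambda>\<beta>. w \<beta> t) \<longlongrightarrow> 0) at_top" using tendsto_norm_zero_iff by blast
    thus ?thesis unfolding w_def u_def D_def by (simp add: LIM_zero_iff)
  qed
  have "((\<lambda>\<beta>. E \<beta> t \<bullet>\<^sub>e (f - P \<bullet>\<^sub>e f) + E \<beta> t \<bullet>\<^sub>e (P \<bullet>\<^sub>e f))
          \<longlongrightarrow> 0 + semigroup_exp (P * A * P) t \<bullet>\<^sub>e (P \<bullet>\<^sub>e f)) at_top"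
    by (intro tendsto_add ker ran) (simp_all add: endo.diff_right idem flip: endo_apply_mult)
  thus ?thesis by (simp add: E_def endo.diff_right)
qed


section \<open>Laplacians of weights with bounded degree\<close>

text \<open>Square-summable real families are elements of \<open>l2\<close>, where this is the
  inequality of the inner product.\<close>

lemma infsum_Cauchy_Schwarz:
  fixes f g :: "'a \<Rightarrow> real"
  assumes "(\<lambda>x. (f x)\<^sup>2) summable_on UNIV" "(\<lambda>x. (g x)\<^sup>2) summable_on UNIV"
  shows "(\<Sum>\<^sub>\<infinity>x. f x * g x)\<^sup>2 \<le> (\<Sum>\<^sub>\<infinity>x. (f x)\<^sup>2) * (\<Sum>\<^sub>\<infinity>x. (g x)\<^sup>2)"
proof -
  define p where "p = Abs_l2 (\<lambda>x. complex_of_real (f x))"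
  define q where "q = Abs_l2 (\<lambda>x. complex_of_real (g x))"
  have pq: "l2_fun p x = f x" "l2_fun q x = g x" for x
    using assms by (simp_all add: p_def q_def Abs_l2_inverse)
  have "(inner p q)\<^sup>2 \<le> (norm p)\<^sup>2 * (norm q)\<^sup>2"
    using Cauchy_Schwarz_ineq[of p q] by (simp add: power2_norm_eq_inner)
  moreover have "inner p q = (\<Sum>\<^sub>\<infinity>x. f x * g x)"
    using infsumI[OF inner_l2_has_sum[of p q]] by (simp add: pq inner_complex_def)
  moreover have "(norm p)\<^sup>2 = (\<Sum>\<^sub>\<infinity>x. (f x)\<^sup>2)" "(norm q)\<^sup>2 = (\<Sum>\<^sub>\<infinity>x. (g x)\<^sup>2)"
    using infsumI[OF norm_l2_has_sum[of p]] infsumI[OF norm_l2_has_sum[of q]] by (simp_all add: pq)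
  ultimately show ?thesis by simp
qed

text \<open>For a bounded family, weak convergence may be tested on a dense set, here on finite
  truncations \<open>h\<close> of \<open>g\<close>, which involve finitely many coordinates.\<close>

lemma l2_weak_tendsto_of_pointwise:
  fixes v :: "'b \<Rightarrow> 'a l2"
  assumes bound: "\<And>\<beta>. norm (v \<beta>) \<le> M"
    and pointwise: "\<And>x. ((\<lambda>\<beta>. l2_fun (v \<beta>) x) \<longlongrightarrow> 0) \<F>"
  shows "((\<lambda>\<beta>. inner (v \<beta>) g) \<longlongrightarrow> 0) \<F>"
proof (rule tendstoI)
  fix e :: real assume e: "0 < e"
  \<comment> \<open>Chosen so that (|M| + 1) d = e/2; the added 1 keeps the denominator
    positive.\<close>
  define d where "d = e / (2 * (\<bar>M\<bar> + 1))"
  have d: "0 < d" using e by (simp add: d_def add_nonneg_pos)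
  have lim: "((\<lambda>F. \<Sum>x\<in>F. (cmod (l2_fun g x))\<^sup>2) \<longlongrightarrow> (norm g)\<^sup>2) (finite_subsets_at_top UNIV)"
    using norm_l2_has_sum[of g] by (simp add: has_sum_def)
  have "\<forall>\<^sub>F F in finite_subsets_at_top UNIV. dist (\<Sum>x\<in>F. (cmod (l2_fun g x))\<^sup>2) ((norm g)\<^sup>2) < d\<^sup>2"
    using tendstoD[OF lim] d by simp
  then obtain F where F: "finite F" "dist (\<Sum>x\<in>F. (cmod (l2_fun g x))\<^sup>2) ((norm g)\<^sup>2) < d\<^sup>2"
    unfolding eventually_finite_subsets_at_top by blast
  define h where "h = Abs_l2 (\<lambda>x. if x \<in> F then l2_fun g x else 0)"
  have "(\<lambda>x. (cmod (if x \<in> F then l2_fun g x else 0))\<^sup>2) summable_on UNIV"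
    by (rule finite_nonzero_values_imp_summable_on, rule finite_subset[of _ F])
       (use F in \<open>auto split: if_splits\<close>)
  hence h: "l2_fun h x = (if x \<in> F then l2_fun g x else 0)" for x
    unfolding h_def by (subst Abs_l2_inverse) simp_all
  have inner_h: "inner k h = (\<Sum>x\<in>F. inner (l2_fun k x) (l2_fun g x))" for k
  proof -
    have "((\<lambda>x. inner (l2_fun k x) (l2_fun h x)) has_sum (\<Sum>x\<in>F. inner (l2_fun k x) (l2_fun h x))) UNIV"
      by (rule has_sum_finite_neutralI) (use F in \<open>auto simp: h\<close>)
    from has_sum_unique[OF this inner_l2_has_sum[of k h]] show ?thesis by (simp add: h)
  qed
  \<comment> \<open>\<open>h\<close> is the orthogonal projection of \<open>g\<close> onto the
    coordinates in \<open>F\<close>, so Pythagoras leaves the tail of the square sum.\<close>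
  have "(norm (g - h))\<^sup>2 = (norm g)\<^sup>2 - (\<Sum>x\<in>F. (cmod (l2_fun g x))\<^sup>2)"
  proof -
    have "inner h h = inner g h" unfolding inner_h by (rule sum.cong) (auto simp: h)
    moreover have "inner g h = (\<Sum>x\<in>F. (cmod (l2_fun g x))\<^sup>2)"
      by (simp add: inner_h power2_norm_eq_inner)
    ultimately show ?thesis
      by (simp add: power2_norm_eq_inner inner_diff_left inner_diff_right inner_commute)
  qed
  also have "\<dots> < d\<^sup>2" using F(2) by (simp add: dist_real_def)
  finally have "norm (g - h) < d" using d by (simp add: power_less_imp_less_base)
  have "((\<lambda>\<beta>. inner (v \<beta>) h) \<longlongrightarrow> (\<Sum>x\<in>F. inner 0 (l2_fun g x))) \<F>"
    unfolding inner_h by (intro tendsto_intros pointwise)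
  hence "\<forall>\<^sub>F \<beta> in \<F>. \<bar>inner (v \<beta>) h\<bar> < e / 2"
    using tendstoD[of "\<lambda>\<beta>. inner (v \<beta>) h" 0 \<F> "e / 2"] e by simp
  thus "\<forall>\<^sub>F \<beta> in \<F>. dist (inner (v \<beta>) g) 0 < e"
  proof eventually_elim
    case (elim \<beta>)
    have "\<bar>inner (v \<beta>) (g - h)\<bar> \<le> norm (v \<beta>) * norm (g - h)" by (rule Cauchy_Schwarz_ineq2)
    also have "\<dots> \<le> (\<bar>M\<bar> + 1) * d"
      using bound[of \<beta>] \<open>norm (g - h) < d\<close> by (intro mult_mono) auto
    also have "\<dots> = e / 2" by (simp add: d_def field_simps)
    finally have "\<bar>inner (v \<beta>) (g - h)\<bar> \<le> e / 2" .
    moreover have "inner (v \<beta>) g = inner (v \<beta>) h + inner (v \<beta>) (g - h)"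
      by (simp add: inner_diff_right)
    ultimately show ?case using elim by simp
  qed
qed

text \<open>The vertex function that \<open>f\<close> represents: the isometry f |-> sqrt(m) f
  undone.\<close>

definition l2_val :: "('a \<Rightarrow> real) \<Rightarrow> 'a l2 \<Rightarrow> 'a \<Rightarrow> complex" where
  "l2_val m f x = l2_fun f x / of_real (sqrt (m x))"

lemma l2_val_linear:
  "l2_val m (f + g) x = l2_val m f x + l2_val m g x"
  "l2_val m (f - g) x = l2_val m f x - l2_val m g x"
  "l2_val m (r *\<^sub>R f) x = r *\<^sub>R l2_val m f x"
  by (simp_all add: l2_val_def plus_l2.rep_eq minus_l2.rep_eq scaleR_l2.rep_eq
        add_divide_distrib diff_divide_distrib scaleR_conv_of_real)

text \<open>Rows are summable rather than finitely supported, so that complete graphs on infinite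
  clusters are instances too. The bound \<open>c\<close> of degree by mass is what bounds the
  Laplacian.\<close>

locale bounded_weight =
  fixes m :: "'a \<Rightarrow> real" and w :: "'a \<Rightarrow> 'a \<Rightarrow> real" and c :: real
  assumes mass_pos: "0 < m x"
    and weight_nonneg: "0 \<le> w x y"
    and weight_sym: "w x y = w y x"
    and weight_summable: "w x summable_on UNIV"
    and weight_le: "(\<Sum>\<^sub>\<infinity>y. w x y) \<le> c * m x"
begin

lemma c_nonneg: "0 \<le> c"
  using infsum_nonneg[of UNIV "w x"] weight_nonneg weight_le[of x] mass_pos[of x]
  by (smt (verit) mult_neg_pos)

lemma l2_fun_eq: "l2_fun f x = of_real (sqrt (m x)) * l2_val m f x"
  using mass_pos[of x] by (simp add: l2_val_def)

lemma cmod_l2_fun_square: "(cmod (l2_fun f x))\<^sup>2 = m x * (cmod (l2_val m f x))\<^sup>2"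
  using mass_pos[of x] by (simp add: l2_fun_eq norm_mult power_mult_distrib)

lemma l2_val_eqI: "(\<And>x. l2_val m f x = l2_val m g x) \<Longrightarrow> f = g"
  by (rule l2_eqI) (simp add: l2_fun_eq)

text \<open>In a rectangle enclosing \<open>F\<close> the inner sums are partial row sums, at most
  \<open>c * m x\<close>; the factor \<open>m x\<close> then turns values back into coordinates of
  \<open>f\<close>.\<close>

lemma sum_weight_fst_le:
  assumes "finite F"
  shows "(\<Sum>(x, y)\<in>F. w x y * (cmod (l2_val m f x))\<^sup>2) \<le> c * (norm f)\<^sup>2"
proof -
  have "(\<Sum>(x, y)\<in>F. w x y * (cmod (l2_val m f x))\<^sup>2)
          \<le> (\<Sum>(x, y)\<in>fst ` F \<times> snd ` F. w x y * (cmod (l2_val m f x))\<^sup>2)"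
    by (rule sum_mono2) (use assms weight_nonneg in \<open>force simp: image_iff\<close>)+
  also have "\<dots> = (\<Sum>x\<in>fst ` F. (\<Sum>y\<in>snd ` F. w x y) * (cmod (l2_val m f x))\<^sup>2)"
    by (simp add: sum.cartesian_product[symmetric] sum_distrib_right)
  also have "\<dots> \<le> (\<Sum>x\<in>fst ` F. c * m x * (cmod (l2_val m f x))\<^sup>2)"
  proof (rule sum_mono, rule mult_right_mono)
    fix x
    have "(\<Sum>y\<in>snd ` F. w x y) \<le> (\<Sum>\<^sub>\<infinity>y. w x y)"
      by (rule finite_sum_le_infsum) (use assms weight_nonneg weight_summable in auto)
    thus "(\<Sum>y\<in>snd ` F. w x y) \<le> c * m x" using weight_le[of x] by linarith
  qed simp
  also have "\<dots> = c * (\<Sum>x\<in>fst ` F. (cmod (l2_fun f x))\<^sup>2)"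
    by (simp add: cmod_l2_fun_square sum_distrib_left mult.assoc)
  also have "\<dots> \<le> c * (norm f)\<^sup>2"
    using assms c_nonneg by (intro mult_left_mono sum_le_norm_l2) auto
  finally show ?thesis .
qed

lemma weight_fst_summable: "(\<lambda>(x, y). w x y * (cmod (l2_val m f x))\<^sup>2) summable_on UNIV"
  by (rule nonneg_bdd_above_summable_on)
     (use sum_weight_fst_le weight_nonneg in \<open>auto intro!: bdd_aboveI[of _ "c * (norm f)\<^sup>2"]\<close>)

lemma sum_weight_snd_le:
  assumes "finite F"
  shows "(\<Sum>(x, y)\<in>F. w x y * (cmod (l2_val m f y))\<^sup>2) \<le> c * (norm f)\<^sup>2"
proof -
  have "(\<Sum>(x, y)\<in>F. w x y * (cmod (l2_val m f y))\<^sup>2)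
          = (\<Sum>(x, y)\<in>prod.swap ` F. w x y * (cmod (l2_val m f x))\<^sup>2)"
    by (subst sum.reindex) (auto simp: case_prod_unfold weight_sym)
  also have "\<dots> \<le> c * (norm f)\<^sup>2" by (rule sum_weight_fst_le) (use assms in auto)
  finally show ?thesis .
qed

text \<open>Each pair occurs in both orders, which the factor 1/2 corrects: the squared norm of the
  gradient is the Dirichlet form <laplace f, f>.\<close>

definition gradient_fun :: "'a l2 \<Rightarrow> 'a \<times> 'a \<Rightarrow> complex" where
  "gradient_fun f = (\<lambda>(x, y). sqrt (w x y / 2) *\<^sub>R (l2_val m f x - l2_val m f y))"

definition gradient :: "'a l2 \<Rightarrow> ('a \<times> 'a) l2" where
  "gradient f = Abs_l2 (gradient_fun f)"

lemma cmod_gradient_fun_square: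
  "(cmod (gradient_fun f (x, y)))\<^sup>2 = w x y / 2 * (cmod (l2_val m f x - l2_val m f y))\<^sup>2"
  using weight_nonneg[of x y] by (simp add: gradient_fun_def power_mult_distrib)

lemma sum_gradient_le:
  assumes "finite F"
  shows "(\<Sum>p\<in>F. (cmod (gradient_fun f p))\<^sup>2) \<le> 2 * c * (norm f)\<^sup>2"
proof -
  have "(\<Sum>p\<in>F. (cmod (gradient_fun f p))\<^sup>2)
          \<le> (\<Sum>(x, y)\<in>F. w x y * (cmod (l2_val m f x))\<^sup>2 + w x y * (cmod (l2_val m f y))\<^sup>2)"
  proof (rule sum_mono, clarify)
    fix x y
    have "(cmod (l2_val m f x - l2_val m f y))\<^sup>2
            \<le> 2 * (cmod (l2_val m f x))\<^sup>2 + 2 * (cmod (l2_val m f y))\<^sup>2"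
      using square_norm_add_le[of "l2_val m f x" "- l2_val m f y"] by simp
    from mult_left_mono[OF this weight_nonneg[of x y]]
    show "(cmod (gradient_fun f (x, y)))\<^sup>2
      \<le> w x y * (cmod (l2_val m f x))\<^sup>2 + w x y * (cmod (l2_val m f y))\<^sup>2"
      by (simp add: cmod_gradient_fun_square algebra_simps)
  qed
  also have "\<dots> \<le> c * (norm f)\<^sup>2 + c * (norm f)\<^sup>2"
    using add_mono[OF sum_weight_fst_le[OF assms] sum_weight_snd_le[OF assms], of f f]
    by (simp add: case_prod_unfold sum.distrib)
  finally show ?thesis by simp
qed

lemma l2_fun_gradient: "l2_fun (gradient f) = gradient_fun f"
  unfolding gradient_def
  by (rule Abs_l2_inverse) (use square_summable_of_bounded_sums[OF sum_gradient_le] in simp)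

lemma norm_gradient_le: "norm (gradient f) \<le> sqrt (2 * c) * norm f"
  by (rule norm_l2_le)
     (use sum_gradient_le c_nonneg in \<open>auto simp: l2_fun_gradient power_mult_distrib\<close>)

lemma gradient_linear:
  "gradient (f + g) = gradient f + gradient g" "gradient (r *\<^sub>R f) = r *\<^sub>R gradient f"
  by (rule l2_eqI, auto simp: l2_fun_gradient plus_l2.rep_eq scaleR_l2.rep_eq gradient_fun_def
        l2_val_linear algebra_simps)+

lemma gradient_has_sum:
  "((\<lambda>x. \<Sum>\<^sub>\<infinity>y. w x y * (cmod (l2_val m f x - l2_val m f y))\<^sup>2) has_sum 2 * (norm (gradient f))\<^sup>2) UNIV"
  and gradient_row_summable:
  "(\<lambda>y. w x y * (cmod (l2_val m f x - l2_val m f y))\<^sup>2) summable_on UNIV"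
proof -
  have *: "((\<lambda>(x, y). w x y * (cmod (l2_val m f x - l2_val m f y))\<^sup>2)
          has_sum 2 * (norm (gradient f))\<^sup>2) (UNIV \<times> UNIV)"
    unfolding UNIV_Times_UNIV
    using has_sum_cmult_right[OF norm_l2_has_sum[of "gradient f"], of 2]
    by (rule has_sum_cong[THEN iffD1, rotated])
       (auto simp: l2_fun_gradient cmod_gradient_fun_square)
  hence row: "(\<lambda>y. w x y * (cmod (l2_val m f x - l2_val m f y))\<^sup>2) summable_on UNIV" for x
    using summable_on_SigmaD1[OF has_sum_imp_summable[OF *]] by simp
  thus "(\<lambda>y. w x y * (cmod (l2_val m f x - l2_val m f y))\<^sup>2) summable_on UNIV" .
  show "((\<lambda>x. \<Sum>\<^sub>\<infinity>y. w x y * (cmod (l2_val m f x - l2_val m f y))\<^sup>2) has_sum 2 * (norm (gradient f))\<^sup>2) UNIV"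
    by (rule has_sum_SigmaD[OF *]) (use row in auto)
qed

text \<open>The Laplacian divides by \<open>m x\<close> and the representation multiplies by its
  square root, hence the single root. Keeping differences together lets rows converge by energy, and
  equal values contribute nothing whatever their weight.\<close>

definition laplace_fun :: "'a l2 \<Rightarrow> 'a \<Rightarrow> complex" where
  "laplace_fun f x = (\<Sum>\<^sub>\<infinity>y. w x y *\<^sub>R (l2_val m f x - l2_val m f y)) / of_real (sqrt (m x))"

definition laplace :: "'a l2 \<Rightarrow> 'a l2" where
  "laplace f = Abs_l2 (laplace_fun f)"

text \<open>By d <= 1 + d^2 the row is dominated by its degree plus its energy.\<close>

lemma laplace_row_abs_summable:
  "(\<lambda>y. norm (w x y *\<^sub>R (l2_val m f x - l2_val m f y))) summable_on UNIV"
proof (rule summable_on_comparison_test)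
  show "(\<lambda>y. w x y + w x y * (cmod (l2_val m f x - l2_val m f y))\<^sup>2) summable_on UNIV"
    by (intro summable_on_add weight_summable gradient_row_summable)
  fix y
  have "cmod (l2_val m f x - l2_val m f y) \<le> 1 + (cmod (l2_val m f x - l2_val m f y))\<^sup>2"
    using sum_squares_bound[of 1 "cmod (l2_val m f x - l2_val m f y)"]
      norm_ge_zero[of "l2_val m f x - l2_val m f y"]
    unfolding one_power2 mult_1_right by linarith
  from mult_left_mono[OF this weight_nonneg[of x y]]
  show "norm (w x y *\<^sub>R (l2_val m f x - l2_val m f y))
      \<le> w x y + w x y * (cmod (l2_val m f x - l2_val m f y))\<^sup>2"
    using weight_nonneg[of x y] by (simp add: distrib_left)
qed simp_all

text \<open>Cauchy-Schwarz for the product of sqrt(w) and sqrt(w) d: the first factor yields the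
  degree, at most \<open>c * m x\<close>, and this \<open>m x\<close> cancels the
  normalization.\<close>

lemma cmod_laplace_fun_square_le:
  "(cmod (laplace_fun f x))\<^sup>2 \<le> c * (\<Sum>\<^sub>\<infinity>y. w x y * (cmod (l2_val m f x - l2_val m f y))\<^sup>2)"
proof -
  define \<delta> where "\<delta> y = cmod (l2_val m f x - l2_val m f y)" for y
  define Q where "Q = (\<Sum>\<^sub>\<infinity>y. w x y * (\<delta> y)\<^sup>2)"
  have Q: "0 \<le> Q" unfolding Q_def by (rule infsum_nonneg) (simp add: weight_nonneg)
  have "cmod (\<Sum>\<^sub>\<infinity>y. w x y *\<^sub>R (l2_val m f x - l2_val m f y)) \<le> (\<Sum>\<^sub>\<infinity>y. sqrt (w x y) * (sqrt (w x y) * \<delta> y))"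
    using norm_infsum_bound[OF laplace_row_abs_summable[of x f]] weight_nonneg
    by (simp add: \<delta>_def mult.assoc[symmetric])
  hence "(cmod (\<Sum>\<^sub>\<infinity>y. w x y *\<^sub>R (l2_val m f x - l2_val m f y)))\<^sup>2
           \<le> (\<Sum>\<^sub>\<infinity>y. sqrt (w x y) * (sqrt (w x y) * \<delta> y))\<^sup>2"
    by (intro power_mono) auto
  also have "\<dots> \<le> (\<Sum>\<^sub>\<infinity>y. (sqrt (w x y))\<^sup>2) * (\<Sum>\<^sub>\<infinity>y. (sqrt (w x y) * \<delta> y)\<^sup>2)"
    by (rule infsum_Cauchy_Schwarz)
       (use weight_nonneg weight_summable gradient_row_summable
         in \<open>auto simp: power_mult_distrib \<delta>_def\<close>)
  also have "\<dots> = (\<Sum>\<^sub>\<infinity>y. w x y) * Q"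
    using weight_nonneg by (simp add: power_mult_distrib Q_def)
  also have "\<dots> \<le> c * m x * Q" by (rule mult_right_mono[OF weight_le Q])
  finally show ?thesis
    using mass_pos[of x] unfolding laplace_fun_def Q_def[symmetric, unfolded \<delta>_def]
    by (simp add: norm_divide power_divide field_simps)
qed

lemma sum_laplace_le:
  assumes "finite F"
  shows "(\<Sum>x\<in>F. (cmod (laplace_fun f x))\<^sup>2) \<le> c * (2 * (norm (gradient f))\<^sup>2)"
proof -
  have "(\<Sum>x\<in>F. (cmod (laplace_fun f x))\<^sup>2)
          \<le> c * (\<Sum>x\<in>F. \<Sum>\<^sub>\<infinity>y. w x y * (cmod (l2_val m f x - l2_val m f y))\<^sup>2)"
    unfolding sum_distrib_left by (rule sum_mono) (rule cmod_laplace_fun_square_le)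
  also have "\<dots> \<le> c * (2 * (norm (gradient f))\<^sup>2)"
    by (intro mult_left_mono c_nonneg finite_sum_le_has_sum[OF gradient_has_sum])
       (use assms weight_nonneg in \<open>auto intro!: infsum_nonneg\<close>)
  finally show ?thesis .
qed

lemma l2_fun_laplace: "l2_fun (laplace f) = laplace_fun f"
  unfolding laplace_def
  by (rule Abs_l2_inverse) (use square_summable_of_bounded_sums[OF sum_laplace_le] in simp)

lemma l2_val_laplace:
  "l2_val m (laplace f) x = (\<Sum>\<^sub>\<infinity>y. w x y *\<^sub>R (l2_val m f x - l2_val m f y)) / of_real (m x)"
  using mass_pos[of x]
  by (simp add: l2_val_def l2_fun_laplace laplace_fun_def flip: of_real_mult)

text \<open>Summation by parts: swap \<open>x\<close> and \<open>y\<close> in the absolutely convergent double sum and average.\<close>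

lemma inner_laplace: "inner (laplace f) g = inner (gradient f) (gradient g)"
proof -
  define \<delta> where "\<delta> x y = l2_val m f x - l2_val m f y" for x y
  define T where "T x y = w x y * inner (\<delta> x y) (l2_val m g x)" for x y
  have "(\<lambda>(x, y). T x y) summable_on UNIV \<times> UNIV"
  proof (rule abs_summable_summable, rule summable_on_comparison_test)
    have "(\<lambda>p. (cmod (gradient_fun f p))\<^sup>2 + (case p of (x, y) \<Rightarrow> w x y * (cmod (l2_val m g x))\<^sup>2))
            summable_on UNIV"
      by (intro summable_on_add weight_fst_summable)
         (use l2_fun_square_summable[of "gradient f"] in \<open>simp add: l2_fun_gradient\<close>)
    thus "(\<lambda>p. (cmod (gradient_fun f p))\<^sup>2 + (case p of (x, y) \<Rightarrow> w x y * (cmod (l2_val m g x))\<^sup>2))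
            summable_on UNIV \<times> UNIV" by simp
    fix p :: "'a \<times> 'a"
    obtain x y where p: "p = (x, y)" by fastforce
    have "\<bar>inner (\<delta> x y) (l2_val m g x)\<bar> \<le> (cmod (\<delta> x y))\<^sup>2 / 2 + (cmod (l2_val m g x))\<^sup>2"
      using abs_inner_le_sum_squares[of "\<delta> x y" "l2_val m g x"] by (simp add: field_simps) (smt (verit) zero_le_power2)
    from mult_left_mono[OF this weight_nonneg[of x y]]
    have "\<bar>T x y\<bar> \<le> w x y / 2 * (cmod (\<delta> x y))\<^sup>2 + w x y * (cmod (l2_val m g x))\<^sup>2"
      using weight_nonneg[of x y] by (simp add: T_def abs_mult distrib_left)
    thus "norm (case p of (x, y) \<Rightarrow> T x y)
      \<le> (cmod (gradient_fun f p))\<^sup>2 + (case p of (x, y) \<Rightarrow> w x y * (cmod (l2_val m g x))\<^sup>2)"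
      unfolding p prod.case cmod_gradient_fun_square \<delta>_def real_norm_def .
  qed simp
  then obtain S where S: "((\<lambda>(x, y). T x y) has_sum S) (UNIV \<times> UNIV)"
    by (auto simp: summable_on_def)
  have row: "((\<lambda>y. T x y) has_sum inner (laplace_fun f x) (l2_fun g x)) UNIV" for x
  proof -
    have "((\<lambda>y. w x y *\<^sub>R \<delta> x y) has_sum (\<Sum>\<^sub>\<infinity>y. w x y *\<^sub>R \<delta> x y)) UNIV"
      unfolding \<delta>_def by (rule has_sum_infsum[OF abs_summable_summable[OF laplace_row_abs_summable]])
    from has_sum_bounded_linear[OF bounded_linear_inner_left this]
    have "((\<lambda>y. T x y) has_sum inner (\<Sum>\<^sub>\<infinity>y. w x y *\<^sub>R \<delta> x y) (l2_val m g x)) UNIV"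
      by (simp add: T_def)
    moreover have "laplace_fun f x = (1 / sqrt (m x)) *\<^sub>R (\<Sum>\<^sub>\<infinity>y. w x y *\<^sub>R \<delta> x y)"
      by (simp add: laplace_fun_def \<delta>_def scaleR_conv_of_real)
    moreover have "l2_fun g x = sqrt (m x) *\<^sub>R l2_val m g x"
      by (simp add: l2_fun_eq scaleR_conv_of_real)
    ultimately show ?thesis using mass_pos[of x] by simp
  qed
  have "((\<lambda>x. inner (laplace_fun f x) (l2_fun g x)) has_sum S) UNIV"
    by (rule has_sum_SigmaD[OF S]) (simp add: row)
  hence S_eq: "inner (laplace f) g = S"
    using has_sum_unique[OF inner_l2_has_sum[of "laplace f" g]] by (simp add: l2_fun_laplace)
  have "((\<lambda>p. (case p of (x, y) \<Rightarrow> T x y) + (case p of (x, y) \<Rightarrow> T y x)) has_sum (S + S)) (UNIV \<times> UNIV)"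
    using has_sum_swap[THEN iffD1, OF S] by (intro has_sum_add S) (simp add: case_prod_unfold)
  moreover have "(case p of (x, y) \<Rightarrow> T x y) + (case p of (x, y) \<Rightarrow> T y x)
      = 2 * inner (gradient_fun f p) (gradient_fun g p)" for p
  proof -
    obtain x y where p: "p = (x, y)" by fastforce
    have "sqrt (w x y / 2) * sqrt (w x y / 2) = w x y / 2"
      using weight_nonneg[of x y] by simp
    hence "2 * inner (gradient_fun f p) (gradient_fun g p)
        = w x y * inner (\<delta> x y) (l2_val m g x - l2_val m g y)"
      by (simp add: p gradient_fun_def \<delta>_def mult.assoc[symmetric])
    thus ?thesis
      by (simp add: p T_def \<delta>_def weight_sym[of y x] inner_diff_left inner_diff_right algebra_simps)
  qed
  ultimately have "((\<lambda>p. 2 * inner (gradient_fun f p) (gradient_fun g p)) has_sum (S + S)) UNIV" by simp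
  from has_sum_unique[OF this has_sum_cmult_right[OF inner_l2_has_sum[of "gradient f" "gradient g"], of 2, unfolded l2_fun_gradient]]
  show ?thesis by (simp add: S_eq)
qed

text \<open>Summation by parts gives both claims without splitting infinite sums: vectors with the
  same inner products against everything coincide, and |laplace f|^2 = <grad f, grad (laplace
  f)>.\<close>

lemma bounded_linear_laplace: "bounded_linear laplace"
proof (rule bounded_linear_intro)
  have eq0: "f = g" if "\<And>h. inner f h = inner g h" for f g :: "'a l2"
    using that[of "f - g"] by (metis inner_diff_left inner_eq_zero_iff right_minus_eq)
  show "laplace (f + g) = laplace f + laplace g" for f g
    by (rule eq0) (simp add: inner_laplace inner_add_left gradient_linear)
  show "laplace (r *\<^sub>R f) = r *\<^sub>R laplace f" for r f
    by (rule eq0) (simp add: inner_laplace gradient_linear)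
  show "norm (laplace f) \<le> norm f * (2 * c)" for f
  proof -
    have "(norm (laplace f))\<^sup>2 = inner (gradient f) (gradient (laplace f))"
      by (simp add: power2_norm_eq_inner inner_laplace)
    also have "\<dots> \<le> norm (gradient f) * norm (gradient (laplace f))" by (rule norm_cauchy_schwarz)
    also have "\<dots> \<le> (sqrt (2 * c) * norm f) * (sqrt (2 * c) * norm (laplace f))"
      by (intro mult_mono norm_gradient_le) (use c_nonneg in auto)
    also have "\<dots> = (norm f * (2 * c)) * norm (laplace f)"
      using c_nonneg by (simp add: algebra_simps flip: real_sqrt_mult)
    finally show ?thesis
      using c_nonneg by (cases "norm (laplace f) = 0") (auto simp: power2_eq_square)
  qed
qed

definition laplace_endo :: "'a l2 endo" where
  "laplace_endo = Endo (Blinfun laplace)"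

lemma laplace_endo_apply: "laplace_endo \<bullet>\<^sub>e f = laplace f"
  by (simp add: laplace_endo_def endo_apply.rep_eq Endo_inverse bounded_linear_Blinfun_apply bounded_linear_laplace)

lemma symmetric_laplace_endo: "symmetric_endo laplace_endo"
  by (simp add: symmetric_endo_def laplace_endo_apply inner_laplace)
     (metis inner_commute inner_laplace)

lemma laplace_nonneg: "0 \<le> inner (laplace f) f"
  by (simp add: inner_laplace)

text \<open>One coordinate of the gradient is at most its norm. Under bounded energy, a weight
  tending to infinity thus forces the difference across its edge to 0.\<close>

lemma edge_energy_le:
  "w x y / 2 * (cmod (l2_val m f x - l2_val m f y))\<^sup>2 \<le> inner (laplace f) f"
  using power_mono[OF l2_fun_le_norm[of "gradient f" "(x, y)"], of 2]
  by (simp only: inner_laplace l2_fun_gradient cmod_gradient_fun_square power2_norm_eq_inner[of "gradient f", symmetric] norm_ge_zero)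

end


section \<open>Functions that are constant on classes\<close>

locale class_partition =
  fixes m :: "'a \<Rightarrow> real" and q :: "'a \<Rightarrow> 'a set"
  assumes mass_pos: "0 < m x"
    and self_class: "x \<in> q x"
    and class_eq: "y \<in> q x \<Longrightarrow> q y = q x"
    and class_summable: "m summable_on q x"
begin

definition class_mass :: "'a \<Rightarrow> real" where
  "class_mass x = infsum m (q x)"

lemma class_mass_pos: "0 < class_mass x"
proof -
  have "(\<Sum>y\<in>{x}. m y) \<le> class_mass x"
    unfolding class_mass_def
    by (rule finite_sum_le_infsum) (use class_summable self_class mass_pos in \<open>auto simp: less_imp_le\<close>)
  thus ?thesis using mass_pos[of x] by simp
qed

text \<open>The orthogonal projection onto the functions that are constant on the classes is
  \<open>1 - L\<close>, where \<open>L\<close> is the Laplacian of the complete graph on each class with the following weights.\<close>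

definition class_weight :: "'a \<Rightarrow> 'a \<Rightarrow> real" where
  "class_weight x y = (if y \<in> q x then m x * m y / class_mass x else 0)"

text \<open>The degree of \<open>x\<close> is exactly its mass: hence the constant 1 of the instance
  below, and the cancellation of the diagonal term in 1 - L.\<close>

lemma class_weight_has_sum: "(class_weight x has_sum m x) UNIV"
proof -
  have "(m has_sum class_mass x) (q x)"
    unfolding class_mass_def using class_summable by simp
  from has_sum_cmult_right[OF this, of "m x / class_mass x"]
  have "((\<lambda>y. m x * m y / class_mass x) has_sum m x) (q x)"
    using class_mass_pos[of x] by simp
  thus ?thesis
    by (rule has_sum_cong_neutral[THEN iffD1, rotated -1]) (auto simp: class_weight_def)
qed

sublocale class_graph: bounded_weight m class_weight 1
proof
  fix x y
  show "0 < m x" by (rule mass_pos)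
  show "0 \<le> class_weight x y"
    using mass_pos[of x] mass_pos[of y] class_mass_pos[of x] by (simp add: class_weight_def)
  have "y \<in> q x \<longleftrightarrow> x \<in> q y" using class_eq self_class by blast
  thus "class_weight x y = class_weight y x"
    using class_eq[of y x] by (auto simp: class_weight_def class_mass_def)
  show "class_weight x summable_on UNIV"
    using class_weight_has_sum has_sum_imp_summable by blast
  show "(\<Sum>\<^sub>\<infinity>y. class_weight x y) \<le> 1 * m x"
    using infsumI[OF class_weight_has_sum, of x] by simp
qed

definition averaging :: "'a l2 endo" where
  "averaging = 1 - class_graph.laplace_endo"

lemma averaging_apply: "averaging \<bullet>\<^sub>e f = f - class_graph.laplace f"
  by (simp add: averaging_def endo.diff_left class_graph.laplace_endo_apply)

lemma symmetric_averaging: "symmetric_endo averaging"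
  using class_graph.symmetric_laplace_endo
  by (simp add: symmetric_endo_def averaging_def endo.diff_left inner_diff_left inner_diff_right)

text \<open>Subtracting the row of differences from the degree row leaves the mass-weighted mean
  over the class; written as a sum over \<open>q x\<close>, it visibly depends on the class
  alone.\<close>

lemma l2_val_averaging:
  "((\<lambda>y. m y *\<^sub>R l2_val m f y) has_sum of_real (class_mass x) * l2_val m (averaging \<bullet>\<^sub>e f) x) (q x)"
proof -
  define S where "S = (\<Sum>\<^sub>\<infinity>y. class_weight x y *\<^sub>R (l2_val m f x - l2_val m f y))"
  have "((\<lambda>y. class_weight x y *\<^sub>R (l2_val m f x - l2_val m f y)) has_sum S) UNIV"
    unfolding S_def
    by (rule has_sum_infsum[OF abs_summable_summable[OF class_graph.laplace_row_abs_summable]])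
  moreover have "((\<lambda>y. class_weight x y *\<^sub>R l2_val m f x) has_sum m x *\<^sub>R l2_val m f x) UNIV"
    by (rule has_sum_bounded_linear[OF bounded_linear_scaleR_left class_weight_has_sum])
  ultimately have "((\<lambda>y. class_weight x y *\<^sub>R l2_val m f x
        + - (class_weight x y *\<^sub>R (l2_val m f x - l2_val m f y))) has_sum (m x *\<^sub>R l2_val m f x + - S)) UNIV"
    by (intro has_sum_add has_sum_uminusI)
  hence "((\<lambda>y. class_weight x y *\<^sub>R l2_val m f y) has_sum (m x *\<^sub>R l2_val m f x - S)) UNIV"
    by (simp add: algebra_simps)
  hence "((\<lambda>y. (m x * m y / class_mass x) *\<^sub>R l2_val m f y) has_sum (m x *\<^sub>R l2_val m f x - S)) (q x)"
    by (rule has_sum_cong_neutral[THEN iffD1, rotated -1]) (auto simp: class_weight_def)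
  from has_sum_scaleR[OF this, of "class_mass x / m x"]
  have "((\<lambda>y. m y *\<^sub>R l2_val m f y) has_sum (class_mass x / m x) *\<^sub>R (m x *\<^sub>R l2_val m f x - S)) (q x)"
    using mass_pos[of x] class_mass_pos[of x] by simp
  moreover have "(class_mass x / m x) *\<^sub>R (m x *\<^sub>R l2_val m f x - S)
      = of_real (class_mass x) * l2_val m (averaging \<bullet>\<^sub>e f) x"
    using mass_pos[of x] unfolding averaging_apply l2_val_linear class_graph.l2_val_laplace S_def[symmetric]
    by (simp add: scaleR_conv_of_real field_simps)
  ultimately show ?thesis by simp
qed

lemma averaging_constant:
  assumes "y \<in> q x"
  shows "l2_val m (averaging \<bullet>\<^sub>e f) y = l2_val m (averaging \<bullet>\<^sub>e f) x"
proof -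
  have "of_real (class_mass x) * l2_val m (averaging \<bullet>\<^sub>e f) y
      = of_real (class_mass x) * l2_val m (averaging \<bullet>\<^sub>e f) x"
    using l2_val_averaging[of f y] unfolding class_mass_def class_eq[OF assms]
    by (rule has_sum_unique[OF _ l2_val_averaging[of f x, unfolded class_mass_def]])
  thus ?thesis using class_mass_pos[of x] by simp
qed

lemma averaging_eq_self:
  assumes "\<And>x y. y \<in> q x \<Longrightarrow> l2_val m f y = l2_val m f x"
  shows "averaging \<bullet>\<^sub>e f = f"
proof -
  have *: "class_weight x y *\<^sub>R (l2_val m f x - l2_val m f y) = 0" for x y
    using assms by (simp add: class_weight_def)
  have "class_graph.laplace f = 0"
    by (rule class_graph.l2_val_eqI)
       (simp add: class_graph.l2_val_laplace *, simp add: l2_val_def zero_l2.rep_eq)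
  thus ?thesis by (simp add: averaging_apply)
qed

lemma averaging_idempotent: "averaging * averaging = averaging"
  by (rule endo_eqI) (simp add: endo_apply_mult averaging_eq_self averaging_constant)

text \<open>If averaging kills \<open>g\<close>, then \<open>g\<close> is its own class Laplacian,
  and <v, g> = <grad v, grad g>. The class gradients of \<open>v\<close> are bounded, and their
  coordinates are weighted differences inside classes, so they tend weakly to 0.\<close>

lemma weak_tendsto_of_differences:
  assumes bound: "\<And>\<beta>. norm (v \<beta>) \<le> M"
    and diff: "\<And>x y. y \<in> q x \<Longrightarrow> ((\<lambda>\<beta>. l2_val m (v \<beta>) x - l2_val m (v \<beta>) y) \<longlongrightarrow> 0) \<F>"
    and g: "averaging \<bullet>\<^sub>e g = 0"
  shows "((\<lambda>\<beta>. inner (v \<beta>) g) \<longlongrightarrow> 0) \<F>"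
proof -
  have "g = class_graph.laplace g" using g by (simp add: averaging_apply)
  hence "inner (v \<beta>) g = inner (class_graph.gradient (v \<beta>)) (class_graph.gradient g)" for \<beta>
    by (metis class_graph.inner_laplace inner_commute)
  moreover have "((\<lambda>\<beta>. inner (class_graph.gradient (v \<beta>)) (class_graph.gradient g)) \<longlongrightarrow> 0) \<F>"
  proof (rule l2_weak_tendsto_of_pointwise)
    show "norm (class_graph.gradient (v \<beta>)) \<le> sqrt (2 * 1) * M" for \<beta>
      using class_graph.norm_gradient_le[of "v \<beta>"] bound[of \<beta>]
      by (smt (verit) mult_left_mono real_sqrt_ge_zero)
    fix p :: "'a \<times> 'a"
    obtain x y where p: "p = (x, y)" by fastforce
    show "((\<lambda>\<beta>. l2_fun (class_graph.gradient (v \<beta>)) p) \<longlongrightarrow> 0) \<F>"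
    proof (cases "y \<in> q x")
      case True
      from tendsto_scaleR[OF tendsto_const diff[OF this], of "sqrt (class_weight x y / 2)"]
      show ?thesis by (simp add: p class_graph.l2_fun_gradient class_graph.gradient_fun_def)
    next
      case False
      thus ?thesis
        by (simp add: p class_graph.l2_fun_gradient class_graph.gradient_fun_def class_weight_def)
    qed
  qed
  ultimately show ?thesis by simp
qed

end

text \<open>The weights have to agree across classes; inside a class they multiply differences that
  averaging has made 0, which gives the independence of \<beta> on the range of
  \<open>P\<close>.\<close>

theorem laplace_semigroup_tendsto:
  fixes w :: "real \<Rightarrow> 'a \<Rightarrow> 'a \<Rightarrow> real" and w0 :: "'a \<Rightarrow> 'a \<Rightarrow> real"
  assumes part: "class_partition m (\<lambda>x. R\<^sup>* `` {x})"
    and bw: "\<And>\<beta>. bounded_weight m (w \<beta>) (c \<beta>)" and bw0: "bounded_weight m w0 c0"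
    and agree: "\<And>\<beta> x y. (x, y) \<notin> R\<^sup>* \<Longrightarrow> w \<beta> x y = w0 x y"
    and diverge: "\<And>x y. (x, y) \<in> R \<Longrightarrow> filterlim (\<lambda>\<beta>. w \<beta> x y) at_top at_top"
    and t: "0 < t"
  defines "P \<equiv> class_partition.averaging m (\<lambda>x. R\<^sup>* `` {x})"
  shows "((\<lambda>\<beta>. semigroup_exp (bounded_weight.laplace_endo m (w \<beta>)) t \<bullet>\<^sub>e f)
           \<longlongrightarrow> semigroup_exp (P * bounded_weight.laplace_endo m w0 * P) t \<bullet>\<^sub>e (P \<bullet>\<^sub>e f)) at_top"
proof -
  interpret class_partition m "\<lambda>x. R\<^sup>* `` {x}" by (rule part)
  interpret w0: bounded_weight m w0 c0 by (rule bw0)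
  interpret w: bounded_weight m "w \<beta>" "c \<beta>" for \<beta> by (rule bw)
  show ?thesis unfolding P_def
  proof (rule semigroup_exp_tendsto_compression)
    show "symmetric_endo (w.laplace_endo \<beta>)" "0 \<le> inner (w.laplace_endo \<beta> \<bullet>\<^sub>e x) x" for \<beta> x
      by (rule w.symmetric_laplace_endo) (simp add: w.laplace_endo_apply w.laplace_nonneg)
    show "symmetric_endo averaging" "averaging * averaging = averaging"
      by (rule symmetric_averaging averaging_idempotent)+
    show "w.laplace_endo \<beta> * averaging = w0.laplace_endo * averaging" for \<beta>
    proof (rule endo_eqI, rule w0.l2_val_eqI)
      fix f x
      have "w \<beta> x y *\<^sub>R (l2_val m (averaging \<bullet>\<^sub>e f) x - l2_val m (averaging \<bullet>\<^sub>e f) y)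
          = w0 x y *\<^sub>R (l2_val m (averaging \<bullet>\<^sub>e f) x - l2_val m (averaging \<bullet>\<^sub>e f) y)" for y
        using agree[of x y \<beta>] averaging_constant[of y x f] by (cases "(x, y) \<in> R\<^sup>*") auto
      hence "(\<Sum>\<^sub>\<infinity>y. w \<beta> x y *\<^sub>R (l2_val m (averaging \<bullet>\<^sub>e f) x - l2_val m (averaging \<bullet>\<^sub>e f) y))
          = (\<Sum>\<^sub>\<infinity>y. w0 x y *\<^sub>R (l2_val m (averaging \<bullet>\<^sub>e f) x - l2_val m (averaging \<bullet>\<^sub>e f) y))"
        by (rule infsum_cong)
      thus "l2_val m ((w.laplace_endo \<beta> * averaging) \<bullet>\<^sub>e f) x
          = l2_val m ((w0.laplace_endo * averaging) \<bullet>\<^sub>e f) x"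
        by (simp add: endo_apply_mult w.laplace_endo_apply w0.laplace_endo_apply
              w.l2_val_laplace w0.l2_val_laplace)
    qed
    fix v :: "real \<Rightarrow> 'a l2" and g M
    assume bound: "\<And>\<beta>. norm (v \<beta>) \<le> M" and energy: "\<And>\<beta>. inner (w.laplace_endo \<beta> \<bullet>\<^sub>e v \<beta>) (v \<beta>) \<le> M"
      and g: "averaging \<bullet>\<^sub>e g = 0"
    have edge: "((\<lambda>\<beta>. l2_val m (v \<beta>) x - l2_val m (v \<beta>) y) \<longlongrightarrow> 0) at_top" if "(x, y) \<in> R" for x y
    proof -
      have "\<forall>\<^sub>F \<beta> in at_top. (cmod (l2_val m (v \<beta>) x - l2_val m (v \<beta>) y))\<^sup>2 \<le> 2 * M / w \<beta> x y"
        \<comment> \<open>Eventually the weight is positive and the energy bound can be divided by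
          it.\<close>
        using filterlim_at_top_dense[THEN iffD1, OF diverge[OF that], rule_format, of 0]
      proof eventually_elim
        case (elim \<beta>)
        have "w \<beta> x y / 2 * (cmod (l2_val m (v \<beta>) x - l2_val m (v \<beta>) y))\<^sup>2 \<le> M"
          using w.edge_energy_le[of \<beta> x y "v \<beta>"] energy[of \<beta>] by (simp add: w.laplace_endo_apply)
        thus ?case using elim by (simp add: field_simps)
      qed
      moreover have "((\<lambda>\<beta>. 2 * M / w \<beta> x y) \<longlongrightarrow> 0) at_top"
        by (rule tendsto_divide_0[OF tendsto_const filterlim_at_top_imp_at_infinity[OF diverge[OF that]]])
      ultimately have sq: "((\<lambda>\<beta>. (cmod (l2_val m (v \<beta>) x - l2_val m (v \<beta>) y))\<^sup>2) \<longlongrightarrow> 0) at_top"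
        by - (rule Lim_null_comparison[where g = "\<lambda>\<beta>. 2 * M / w \<beta> x y"], simp_all)
      have "((\<lambda>\<beta>. cmod (l2_val m (v \<beta>) x - l2_val m (v \<beta>) y)) \<longlongrightarrow> 0) at_top"
        using tendsto_real_sqrt[OF sq] by simp
      thus ?thesis using tendsto_norm_zero_iff by blast
    qed
    \<comment> \<open>Telescoping along a finite path, whose length may vary with the pair since the
      convergence is pointwise.\<close>
    have path: "((\<lambda>\<beta>. l2_val m (v \<beta>) x - l2_val m (v \<beta>) y) \<longlongrightarrow> 0) at_top" if "(x, y) \<in> R\<^sup>*" for x y
      using that
    proof (induction rule: rtrancl_induct)
      case (step y z)
      from tendsto_add[OF step.IH edge[OF step.hyps(2)]] show ?case
        by (simp only: diff_add_cancel add_0_left add_diff_eq)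
    qed simp
    show "((\<lambda>\<beta>. inner (v \<beta>) g) \<longlongrightarrow> 0) at_top"
      by (rule weak_tendsto_of_differences[OF bound path g]) simp
  qed (rule t)
qed


section \<open>The heat semigroup of a weighted graph\<close>

lemma bounded_linear_l2_fun: "bounded_linear (\<lambda>h. l2_fun h x)"
  by (rule bounded_linear_intro[of _ 1])
     (simp_all add: plus_l2.rep_eq scaleR_l2.rep_eq l2_fun_le_norm)

text \<open>Mass 1 off the vertex set keeps the mass positive on the whole type.\<close>

definition ext_mass :: "'v wgraph \<Rightarrow> 'v \<Rightarrow> real" where
  "ext_mass G x = (if x \<in> verts G then mass G x else 1)"

definition ext_weight :: "'v wgraph \<Rightarrow> 'v \<Rightarrow> 'v \<Rightarrow> real" where
  "ext_weight G x y = (if x \<in> verts G \<and> y \<in> verts G then weight G x y else 0)"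

text \<open>For \<open>V\<close> the vertex set, the copy of \<open>ell2 G\<close> in
  \<open>'v l2\<close>: a closed subspace in place of a type depending on \<open>G\<close>.\<close>

definition supported_on :: "'v set \<Rightarrow> 'v l2 set" where
  "supported_on V = {h. \<forall>x. x \<notin> V \<longrightarrow> l2_fun h x = 0}"

lemma subspace_supported_on: "subspace (supported_on V)"
  by (auto simp: supported_on_def subspace_def plus_l2.rep_eq scaleR_l2.rep_eq zero_l2.rep_eq)

lemma closed_supported_on: "closed (supported_on V)"
proof -
  have "supported_on V = (\<Inter>x\<in>-V. {h. l2_fun h x = 0})" by (auto simp: supported_on_def)
  also have "closed \<dots>"
    by (intro closed_INT ballI closed_Collect_eq continuous_intros
          bounded_linear.continuous_on[OF bounded_linear_l2_fun])
  finally show ?thesis .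
qed

lemma graph_bounded_weight:
  assumes G: "weighted_graph G" and "undirected G" and "degree_bounded G"
  shows "\<exists>c. bounded_weight (ext_mass G) (ext_weight G) c"
proof -
  obtain C where C: "C > 0" "\<And>v. v \<in> verts G \<Longrightarrow> degree G v \<le> C * mass G v"
    using assms(3) by (auto simp: degree_bounded_def)
  have "bounded_weight (ext_mass G) (ext_weight G) C"
  proof
    fix x y
    show "0 < ext_mass G x" "0 \<le> ext_weight G x y"
      using G by (auto simp: weighted_graph_def ext_mass_def ext_weight_def)
    show "ext_weight G x y = ext_weight G y x"
      using assms(2) by (auto simp: undirected_def ext_weight_def)
    have "{y. ext_weight G x y \<noteq> 0} \<subseteq> (if x \<in> verts G then {y. (x, y) \<in> edges G} else {})"
      using G by (auto simp: weighted_graph_def ext_weight_def less_le)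
    moreover have "finite (if x \<in> verts G then {y. (x, y) \<in> edges G} else {})"
      using G by (auto simp: weighted_graph_def)
    ultimately show "ext_weight G x summable_on UNIV"
      by (intro finite_nonzero_values_imp_summable_on) (simp add: finite_subset)
    show "(\<Sum>\<^sub>\<infinity>y. ext_weight G x y) \<le> C * ext_mass G x"
    proof (cases "x \<in> verts G")
      case True
      have "(\<Sum>\<^sub>\<infinity>y. ext_weight G x y) = degree G x"
        unfolding degree_def by (rule infsum_cong_neutral) (use True in \<open>auto simp: ext_weight_def\<close>)
      thus ?thesis using C(2) True by (simp add: ext_mass_def)
    next
      case False
      hence "ext_weight G x = (\<lambda>_. 0)" by (auto simp: ext_weight_def)
      thus ?thesis using C(1) False by (simp add: ext_mass_def)
    qed
  qed
  thus ?thesis ..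
qed

text \<open>\<open>\<Phi>\<close> maps the closed subspace \<open>K\<close> isometrically onto
  \<open>ell2 H\<close> and intertwines \<open>B\<close> with \<open>A\<close>, so partial sums of
  one exponential go to those of the other. This resolves the definite description in
  \<open>ell2_exp\<close>, for \<open>G\<close> and for the reduced graph alike.\<close>

lemma ell2_exp_transport:
  fixes \<Phi> :: "'x::{real_inner, banach, perfect_space} \<Rightarrow> 'c \<Rightarrow> complex"
  assumes K: "subspace K" "closed K" and range: "\<Phi> ` K = ell2 H"
    and norm: "\<And>h. h \<in> K \<Longrightarrow> ell2_norm H (\<Phi> h) = norm h"
    and add: "\<And>h k v. \<Phi> (h + k) v = \<Phi> h v + \<Phi> k v"
    and scale: "\<And>r h v. \<Phi> (r *\<^sub>R h) v = r *\<^sub>R \<Phi> h v"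
    and B: "\<And>h. h \<in> K \<Longrightarrow> B \<bullet>\<^sub>e h \<in> K" and A: "\<And>h. h \<in> K \<Longrightarrow> A (\<Phi> h) = \<Phi> (B \<bullet>\<^sub>e h)"
    and h: "h \<in> K"
  shows "ell2_exp H A (\<Phi> h) = \<Phi> (exp B \<bullet>\<^sub>e h)" and "exp B \<bullet>\<^sub>e h \<in> K"
proof -
  have BK: "B ^ n \<bullet>\<^sub>e h \<in> K" for n by (induction n) (simp_all add: h B endo_apply_mult)
  have AB: "(A ^^ n) (\<Phi> h) = \<Phi> (B ^ n \<bullet>\<^sub>e h)" for n
    by (induction n) (simp_all add: A BK endo_apply_mult)
  define S where "S N = (\<Sum>n<N. (B ^ n \<bullet>\<^sub>e h) /\<^sub>R fact n)" for N
  have SK: "S N \<in> K" for N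
    unfolding S_def by (intro subspace_sum subspace_scale K BK)
  have \<Phi>0: "\<Phi> 0 v = 0" for v using scale[of 0 0 v] by simp
  have \<Phi>S: "(\<lambda>v. \<Sum>n<N. (A ^^ n) (\<Phi> h) v / fact n) = \<Phi> (S N)" for N
    unfolding S_def
    by (induction N) (auto simp: \<Phi>0 add scale AB fun_eq_iff scaleR_conv_of_real field_simps)
  have \<Phi>diff: "(\<lambda>v. \<Phi> a v - \<Phi> b v) = \<Phi> (a - b)" for a b
    using add[of "a - b" b] by (auto simp: fun_eq_iff)
  have tendsto_iff: "ell2_tendsto H (\<lambda>N v. \<Sum>n<N. (A ^^ n) (\<Phi> h) v / fact n) (\<Phi> k) sequentially
      \<longleftrightarrow> S \<longlonglongrightarrow> k" if "k \<in> K" for k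
  proof -
    have "ell2_norm H (\<lambda>v. \<Phi> (S N) v - \<Phi> k v) = norm (S N - k)" for N
      by (simp add: \<Phi>diff norm subspace_diff K SK that)
    moreover have "\<Phi> (S N) \<in> ell2 H" "\<Phi> k \<in> ell2 H" for N using range SK that by auto
    ultimately show ?thesis
      unfolding ell2_tendsto_def \<Phi>S by (simp add: tendsto_norm_zero_iff LIM_zero_iff)
  qed
  have S: "S \<longlonglongrightarrow> exp B \<bullet>\<^sub>e h"
    using exp_endo_sums[of B h] by (simp add: S_def[abs_def] sums_def)
  \<comment> \<open>Closedness keeps the limit where \<open>\<Phi>\<close> is known to be
    isometric.\<close>
  show eK: "exp B \<bullet>\<^sub>e h \<in> K"
    using closed_sequentially[OF K(2) _ S] SK by simp
  show "ell2_exp H A (\<Phi> h) = \<Phi> (exp B \<bullet>\<^sub>e h)"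
    unfolding ell2_exp_def
  proof (rule the_equality)
    show "ell2_tendsto H (\<lambda>N v. \<Sum>n<N. (A ^^ n) (\<Phi> h) v / fact n) (\<Phi> (exp B \<bullet>\<^sub>e h)) sequentially"
      using tendsto_iff[OF eK] S by simp
    \<comment> \<open>A competing limit lies in \<open>ell2 H\<close> by the definition of
      convergence, hence in the image of \<open>K\<close>, where limits are unique.\<close>
    fix g assume g: "ell2_tendsto H (\<lambda>N v. \<Sum>n<N. (A ^^ n) (\<Phi> h) v / fact n) g sequentially"
    hence "g \<in> \<Phi> ` K" unfolding range by (simp add: ell2_tendsto_def)
    then obtain k where k: "k \<in> K" "g = \<Phi> k" by auto
    with g tendsto_iff have "S \<longlonglongrightarrow> k" by simp
    thus "g = \<Phi> (exp B \<bullet>\<^sub>e h)" using LIMSEQ_unique[OF S] k by simp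
  qed
qed

lemma heat_transport:
  fixes \<Phi> :: "'x::{real_inner, banach, perfect_space} \<Rightarrow> 'c \<Rightarrow> complex"
  assumes K: "subspace K" "closed K" and range: "\<Phi> ` K = ell2 H"
    and norm: "\<And>h. h \<in> K \<Longrightarrow> ell2_norm H (\<Phi> h) = norm h"
    and add: "\<And>h k v. \<Phi> (h + k) v = \<Phi> h v + \<Phi> k v"
    and scale: "\<And>r h v. \<Phi> (r *\<^sub>R h) v = r *\<^sub>R \<Phi> h v"
    and B: "\<And>h. h \<in> K \<Longrightarrow> B \<bullet>\<^sub>e h \<in> K"
    and laplacian: "\<And>h. h \<in> K \<Longrightarrow> laplacian H (\<Phi> h) = \<Phi> (B \<bullet>\<^sub>e h)"
    and h: "h \<in> K"
  shows "heat H t (\<Phi> h) = \<Phi> (semigroup_exp B t \<bullet>\<^sub>e h)" and "semigroup_exp B t \<bullet>\<^sub>e h \<in> K"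
proof -
  have eq: "(t *\<^sub>R - B) \<bullet>\<^sub>e h = (- t) *\<^sub>R (B \<bullet>\<^sub>e h)" for h
    by (simp add: endo.scaleR_left endo.minus_left)
  have 1: "(t *\<^sub>R - B) \<bullet>\<^sub>e h \<in> K" if "h \<in> K" for h
    unfolding eq by (intro subspace_scale K B that)
  have 2: "(\<lambda>x. of_real (- t) * laplacian H (\<Phi> h) x) = \<Phi> ((t *\<^sub>R - B) \<bullet>\<^sub>e h)" if "h \<in> K" for h
    unfolding eq by (simp only: laplacian[OF that] scale fun_eq_iff scaleR_conv_of_real) simp
  show "heat H t (\<Phi> h) = \<Phi> (semigroup_exp B t \<bullet>\<^sub>e h)"
    unfolding heat_def semigroup_exp_def
    by (rule ell2_exp_transport(1)[OF K range norm add scale 1 2 h])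
  show "semigroup_exp B t \<bullet>\<^sub>e h \<in> K"
    unfolding semigroup_exp_def
    by (rule ell2_exp_transport(2)[OF K range norm add scale 1 2 h])
qed

section \<open>\<open>ell2 G\<close> and its Laplacian inside \<open>l2\<close>\<close>

locale bounded_graph = bounded_weight "ext_mass G" "ext_weight G" c
  for G :: "'v wgraph" and c :: real
begin

abbreviation val :: "'v l2 \<Rightarrow> 'v \<Rightarrow> complex" where "val \<equiv> l2_val (ext_mass G)"

lemma mass_eq: "x \<in> verts G \<Longrightarrow> mass G x = ext_mass G x"
  by (simp add: ext_mass_def)

lemma val_outside: "h \<in> supported_on (verts G) \<Longrightarrow> x \<notin> verts G \<Longrightarrow> val h x = 0"
  by (simp add: supported_on_def l2_val_def)

lemma supported_onI: "(\<And>x. x \<notin> verts G \<Longrightarrow> val h x = 0) \<Longrightarrow> h \<in> supported_on (verts G)"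
  by (simp add: supported_on_def l2_fun_eq)

lemma val_has_sum:
  assumes "h \<in> supported_on (verts G)"
  shows "((\<lambda>v. (cmod (val h v))\<^sup>2 * mass G v) has_sum (norm h)\<^sup>2) (verts G)"
  by (rule has_sum_cong_neutral[THEN iffD1, OF _ _ _ norm_l2_has_sum[of h]])
     (use assms in \<open>auto simp: cmod_l2_fun_square val_outside mass_eq\<close>)

lemma val_ell2: "h \<in> supported_on (verts G) \<Longrightarrow> val h \<in> ell2 G"
  using has_sum_imp_summable[OF val_has_sum] by (simp add: ell2_def val_outside)

lemma ell2_norm_val: "h \<in> supported_on (verts G) \<Longrightarrow> ell2_norm G (val h) = norm h"
  using infsumI[OF val_has_sum, of h] by (simp add: ell2_norm_def)

lemma ell2_ex_val:
  assumes "f \<in> ell2 G"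
  obtains h where "h \<in> supported_on (verts G)" "f = val h"
proof
  define h where "h = Abs_l2 (\<lambda>x. of_real (sqrt (ext_mass G x)) * f x)"
  have f: "f v = 0" if "v \<notin> verts G" for v using assms that by (simp add: ell2_def)
  have "(\<lambda>v. (cmod (f v))\<^sup>2 * mass G v) summable_on verts G" using assms by (simp add: ell2_def)
  hence "(\<lambda>x. (cmod (of_real (sqrt (ext_mass G x)) * f x))\<^sup>2) summable_on UNIV"
    by (rule summable_on_cong_neutral[THEN iffD1, rotated -1])
       (use mass_pos in \<open>auto simp: f norm_mult power_mult_distrib mass_eq less_imp_le\<close>)
  hence h: "l2_fun h x = of_real (sqrt (ext_mass G x)) * f x" for x
    unfolding h_def by (subst Abs_l2_inverse) simp_all
  show "h \<in> supported_on (verts G)" by (simp add: supported_on_def h f)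
  show "f = val h" using mass_pos by (auto simp: fun_eq_iff l2_val_def h less_imp_neq[symmetric])
qed

lemma val_image: "val ` supported_on (verts G) = ell2 G"
  using val_ell2 ell2_ex_val by blast

lemma laplace_supported:
  assumes "h \<in> supported_on (verts G)"
  shows "laplace h \<in> supported_on (verts G)"
  by (rule supported_onI) (simp add: l2_val_laplace ext_weight_def)

text \<open>The degree row and the row of differences both converge, hence so does this one. It
  leads from the difference form of \<open>laplace\<close> to the degree-minus-adjacency form of
  \<open>laplacian\<close>.\<close>

lemma weighted_row_has_sum:
  "((\<lambda>y. ext_weight G x y *\<^sub>R val h y) has_sum
      (\<Sum>\<^sub>\<infinity>y. ext_weight G x y) *\<^sub>R val h x - of_real (ext_mass G x) * val (laplace h) x) UNIV"
proof -
  have 1: "((\<lambda>y. ext_weight G x y *\<^sub>R (val h x - val h y)) has_sum of_real (ext_mass G x) * val (laplace h) x) UNIV"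
    using has_sum_infsum[OF abs_summable_summable[OF laplace_row_abs_summable[of x h]]] mass_pos[of x]
    by (simp add: l2_val_laplace)
  have 2: "((\<lambda>y. ext_weight G x y *\<^sub>R val h x) has_sum (\<Sum>\<^sub>\<infinity>y. ext_weight G x y) *\<^sub>R val h x) UNIV"
    by (rule has_sum_bounded_linear[OF bounded_linear_scaleR_left has_sum_infsum[OF weight_summable]])
  from has_sum_add[OF 2 has_sum_uminusI[OF 1]]
  show ?thesis by (simp add: scaleR_diff_right)
qed

lemma laplacian_val:
  assumes "h \<in> supported_on (verts G)"
  shows "laplacian G (val h) = val (laplace h)"
proof
  fix x
  show "laplacian G (val h) x = val (laplace h) x"
  proof (cases "x \<in> verts G")
    case True
    have deg: "degree G x = (\<Sum>\<^sub>\<infinity>y. ext_weight G x y)"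
      unfolding degree_def by (rule infsum_cong_neutral) (use True in \<open>auto simp: ext_weight_def\<close>)
    have "(\<Sum>\<^sub>\<infinity>y\<in>verts G. of_real (weight G x y) * val h y) = (\<Sum>\<^sub>\<infinity>y. ext_weight G x y *\<^sub>R val h y)"
      by (rule infsum_cong_neutral) (use True in \<open>auto simp: ext_weight_def scaleR_conv_of_real\<close>)
    also have "\<dots> = (\<Sum>\<^sub>\<infinity>y. ext_weight G x y) *\<^sub>R val h x - of_real (ext_mass G x) * val (laplace h) x"
      by (rule infsumI[OF weighted_row_has_sum])
    finally show ?thesis using True mass_pos[of x]
      by (simp add: laplacian_def deg mass_eq scaleR_conv_of_real)
  next
    case False
    thus ?thesis using val_outside[OF laplace_supported[OF assms]] by (simp add: laplacian_def)
  qed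
qed

lemma heat_val:
  assumes "h \<in> supported_on (verts G)"
  shows "heat G t (val h) = val (semigroup_exp laplace_endo t \<bullet>\<^sub>e h)"
    and "semigroup_exp laplace_endo t \<bullet>\<^sub>e h \<in> supported_on (verts G)"
  by (rule heat_transport[OF subspace_supported_on closed_supported_on val_image ell2_norm_val];
      simp add: l2_val_linear laplace_endo_apply laplace_supported laplacian_val assms)+

end


section \<open>The reduced graph\<close>

text \<open>By disjointness \<open>snd\<close> is a bijection from \<open>Sigma A B\<close> onto the
  union, and a sum over \<open>Sigma A B\<close> can be taken fibre by fibre.\<close>

lemma has_sum_UnionD:
  fixes f :: "'a \<Rightarrow> 'c :: {topological_comm_monoid_add, t3_space}"
  assumes sum: "(f has_sum S) (\<Union>x\<in>A. B x)"
    and part: "\<And>x. x \<in> A \<Longrightarrow> (f has_sum g x) (B x)"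
    and disj: "disjoint_family_on B A"
  shows "(g has_sum S) A"
proof -
  have inj: "inj_on snd (Sigma A B)"
    using disj by (intro inj_onI) (force simp: disjoint_family_on_def)
  have "(\<Union>x\<in>A. B x) = snd ` Sigma A B" by (force simp: Sigma_def)
  with sum has_sum_reindex[OF inj, of f S] have "((f \<circ> snd) has_sum S) (Sigma A B)" by simp
  thus ?thesis by (rule has_sum_SigmaD) (simp add: part)
qed

locale clustered_graph = bounded_graph G c + part: class_partition "ext_mass G" "\<lambda>x. F\<^sup>* `` {x}"
  for G :: "'v wgraph" and c :: real and F :: "('v \<times> 'v) set" +
  assumes F_verts: "F \<subseteq> verts G \<times> verts G"
begin

abbreviation cls :: "'v \<Rightarrow> 'v set" where "cls x \<equiv> F\<^sup>* `` {x}"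

abbreviation red :: "'v set wgraph" where "red \<equiv> reduced_graph G F"

section \<open>Classes as vertices of the reduced graph\<close>

lemma class_verts:
  assumes "x \<in> verts G" "y \<in> cls x"
  shows "y \<in> verts G"
proof -
  have "(x, y) \<in> F\<^sup>*" using assms by simp
  thus ?thesis by (induction rule: rtrancl_induct) (use assms F_verts in auto)
qed

lemma class_outside:
  assumes "x \<notin> verts G"
  shows "cls x = {x}"
proof -
  have "y = x" if "(x, y) \<in> F\<^sup>*" for y
    using that by (cases rule: converse_rtranclE) (use assms F_verts in auto)
  thus ?thesis by auto
qed

lemma verts_red: "verts red = cls ` verts G"
proof -
  have "(F\<^sup>* \<inter> verts G \<times> verts G) `` {x} = cls x" if "x \<in> verts G" for x
    using class_verts[OF that] that by auto
  thus ?thesis by (auto simp: reduced_graph_def components_def quotient_def)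
qed

lemma Union_verts_red: "(\<Union>C\<in>verts red. C) = verts G"
  using class_verts part.self_class by (auto simp: verts_red)

lemma disjoint_verts_red: "disjoint_family_on (\<lambda>C. C) (verts red)"
  using part.class_eq unfolding disjoint_family_on_def verts_red by blast

lemma mass_red: "x \<in> verts G \<Longrightarrow> mass red (cls x) = part.class_mass x"
  unfolding part.class_mass_def reduced_graph_def
  by (auto intro!: infsum_cong simp: mass_eq class_verts)

section \<open>\<open>J_down\<close> and \<open>J_up\<close> in terms of averaging\<close>

lemma J_down_class:
  assumes x: "x \<in> verts G"
  shows "J_down G F (val h) (cls x) = val (part.averaging \<bullet>\<^sub>e h) x"
proof -
  have "ell2_inner G (indicator (cls x)) (val h) = (\<Sum>\<^sub>\<infinity>y\<in>cls x. ext_mass G y *\<^sub>R val h y)"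
    unfolding ell2_inner_def
    by (rule infsum_cong_neutral)
       (use class_verts[OF x] in \<open>auto simp: indicator_def mass_eq scaleR_conv_of_real\<close>)
  also have "\<dots> = of_real (part.class_mass x) * val (part.averaging \<bullet>\<^sub>e h) x"
    by (rule infsumI[OF part.l2_val_averaging])
  finally show ?thesis
    using x part.class_mass_pos[of x] by (simp add: J_down_def verts_red mass_red)
qed

lemma J_down_outside: "C \<notin> verts red \<Longrightarrow> J_down G F f C = 0"
  by (simp add: J_down_def)

lemma J_up_eq:
  assumes "x \<in> verts G"
  shows "J_up G F k x = k (cls x)"
proof -
  have "C = cls x" if "C \<in> verts red" "x \<in> C" for C
    using that part.class_eq by (auto simp: verts_red)
  hence "J_up G F k x = (\<Sum>\<^sub>\<infinity>C\<in>{cls x}. k C)"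
    unfolding J_up_def
    by (intro infsum_cong_neutral) (use assms in \<open>auto simp: verts_red indicator_def\<close>)
  thus ?thesis by simp
qed

lemma J_up_outside: "x \<notin> verts G \<Longrightarrow> J_up G F k x = 0"
  unfolding J_up_def using Union_verts_red by (intro infsum_0) (auto simp: indicator_def)

text \<open>The copy of \<open>ell2 red\<close> inside \<open>'v l2\<close>. Keeping it in the space
  of \<open>G\<close> makes the reduced Laplacian a compression of the original one.\<close>

definition lifted :: "'v l2 set" where
  "lifted = {h \<in> supported_on (verts G). part.averaging \<bullet>\<^sub>e h = h}"

lemma liftedD: "h \<in> lifted \<Longrightarrow> h \<in> supported_on (verts G)" "h \<in> lifted \<Longrightarrow> part.averaging \<bullet>\<^sub>e h = h"
  by (auto simp: lifted_def)

lemma subspace_lifted: "subspace lifted"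
  using subspace_supported_on[of "verts G"]
  by (auto simp: lifted_def subspace_def endo.add_right endo.scaleR_right endo.zero_right)

lemma closed_lifted: "closed lifted"
proof -
  have "lifted = supported_on (verts G) \<inter> {h. part.averaging \<bullet>\<^sub>e h = h}"
    by (auto simp: lifted_def)
  also have "closed \<dots>"
    by (intro closed_Int closed_supported_on closed_Collect_eq continuous_intros
          bounded_linear.continuous_on[OF endo.bounded_linear_right])
  finally show ?thesis .
qed

text \<open>A point outside the vertex set is its own class, so averaging creates no value
  there.\<close>

lemma averaging_supported:
  assumes "h \<in> supported_on (verts G)"
  shows "part.averaging \<bullet>\<^sub>e h \<in> lifted"
proof -
  have "val (part.averaging \<bullet>\<^sub>e h) x = 0" if "x \<notin> verts G" for x
  proof -
    have "((\<lambda>y. ext_mass G y *\<^sub>R val h y) has_sum 0) {x}"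
      using assms that by (intro has_sum_0) (simp add: val_outside)
    from has_sum_unique[OF part.l2_val_averaging[of h x, unfolded class_outside[OF that]] this]
    show ?thesis using part.class_mass_pos[of x] by simp
  qed
  thus ?thesis
    by (simp add: lifted_def supported_onI part.averaging_idempotent flip: endo_apply_mult)
qed

lemma J_down_val: "h \<in> lifted \<Longrightarrow> x \<in> verts G \<Longrightarrow> J_down G F (val h) (cls x) = val h x"
  by (simp add: J_down_class liftedD)

lemma J_up_J_down:
  assumes "h \<in> lifted"
  shows "J_up G F (J_down G F (val h)) = val h"
proof
  fix x
  show "J_up G F (J_down G F (val h)) x = val h x"
    using assms
    by (cases "x \<in> verts G")
       (simp_all add: J_up_eq J_down_val J_up_outside val_outside liftedD)
qed

lemma J_down_averaging: "J_down G F (val (part.averaging \<bullet>\<^sub>e h)) = J_down G F (val h)"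
proof
  fix C
  show "J_down G F (val (part.averaging \<bullet>\<^sub>e h)) C = J_down G F (val h) C"
    by (cases "C \<in> verts red")
       (auto simp: verts_red J_down_class J_down_outside part.averaging_idempotent
         simp flip: endo_apply_mult)
qed

section \<open>Square sums over vertices and over classes\<close>

lemma mass_class_has_sum:
  assumes "x \<in> verts G"
  shows "((\<lambda>y. (cmod (k (cls y)))\<^sup>2 * mass G y) has_sum (cmod (k (cls x)))\<^sup>2 * mass red (cls x)) (cls x)"
proof -
  have "(ext_mass G has_sum mass red (cls x)) (cls x)"
    unfolding mass_red[OF assms] part.class_mass_def using part.class_summable by simp
  from has_sum_cmult_right[OF this, of "(cmod (k (cls x)))\<^sup>2"]
  show ?thesis
    by (rule has_sum_cong[THEN iffD1, rotated])
       (use part.class_eq class_verts[OF assms] in \<open>auto simp: mass_eq\<close>)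
qed

lemma lift_square_summable:
  "(\<lambda>y. (cmod (k (cls y)))\<^sup>2 * mass G y) summable_on verts G
     \<longleftrightarrow> (\<lambda>C. (cmod (k C))\<^sup>2 * mass red C) summable_on verts red"
  unfolding Union_verts_red[symmetric]
  by (rule summable_on_Union_iff[OF _ _ disjoint_verts_red])
     (auto simp: verts_red mass_eq class_verts intro!: mass_class_has_sum mult_nonneg_nonneg less_imp_le[OF mass_pos])

lemma J_down_val_has_sum:
  assumes h: "h \<in> lifted"
  shows "((\<lambda>C. (cmod (J_down G F (val h) C))\<^sup>2 * mass red C) has_sum (norm h)\<^sup>2) (verts red)"
proof -
  have "((\<lambda>y. (cmod (J_down G F (val h) (cls y)))\<^sup>2 * mass G y) has_sum (norm h)\<^sup>2) (verts G)"
    using val_has_sum[OF liftedD(1)[OF h]]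
    by (rule has_sum_cong[THEN iffD1, rotated]) (simp add: J_down_val h)
  thus ?thesis
    unfolding Union_verts_red[symmetric]
    by (rule has_sum_UnionD[OF _ _ disjoint_verts_red]) (auto simp: verts_red intro: mass_class_has_sum)
qed

lemma J_down_val_ell2: "h \<in> lifted \<Longrightarrow> J_down G F (val h) \<in> ell2 red"
  using has_sum_imp_summable[OF J_down_val_has_sum] by (simp add: ell2_def J_down_outside)

lemma ell2_norm_J_down_val: "h \<in> lifted \<Longrightarrow> ell2_norm red (J_down G F (val h)) = norm h"
  using infsumI[OF J_down_val_has_sum, of h] by (simp add: ell2_norm_def)

text \<open>A preimage of \<open>k\<close> is represented by \<open>J_up G F k\<close>, which is
  constant on classes and square summable after regrouping by classes.\<close>

lemma J_down_image: "(\<lambda>h. J_down G F (val h)) ` lifted = ell2 red"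
proof
  show "(\<lambda>h. J_down G F (val h)) ` lifted \<subseteq> ell2 red" using J_down_val_ell2 by auto
  show "ell2 red \<subseteq> (\<lambda>h. J_down G F (val h)) ` lifted"
  proof
    fix k assume k: "k \<in> ell2 red"
    have "(\<lambda>y. (cmod (J_up G F k y))\<^sup>2 * mass G y) summable_on verts G
        \<longleftrightarrow> (\<lambda>y. (cmod (k (cls y)))\<^sup>2 * mass G y) summable_on verts G"
      by (rule summable_on_cong) (simp add: J_up_eq)
    hence "J_up G F k \<in> ell2 G"
      using k lift_square_summable[of k] by (simp add: ell2_def J_up_outside)
    then obtain h where h: "h \<in> supported_on (verts G)" "J_up G F k = val h"
      by (rule ell2_ex_val)
    have "part.averaging \<bullet>\<^sub>e h = h"
    proof (rule part.averaging_eq_self)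
      fix x y assume y: "y \<in> cls x"
      show "val h y = val h x"
      proof (cases "x \<in> verts G")
        case True
        thus ?thesis using y class_verts[OF True y] part.class_eq[OF y] by (simp add: J_up_eq flip: h(2))
      next
        case False
        thus ?thesis using y class_outside by auto
      qed
    qed
    hence lifted: "h \<in> lifted" using h by (simp add: lifted_def)
    have "J_down G F (val h) C = k C" for C
    proof (cases "C \<in> verts red")
      case True
      then obtain x where "x \<in> verts G" "C = cls x" by (auto simp: verts_red)
      thus ?thesis using J_down_val[OF lifted, of x] J_up_eq[of x k] h(2) by simp
    next
      case False
      thus ?thesis using k by (simp add: J_down_outside ell2_def)
    qed
    hence "k = J_down G F (val h)" by (simp add: fun_eq_iff)
    thus "k \<in> (\<lambda>h. J_down G F (val h)) ` lifted" using lifted by blast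
  qed
qed

text \<open>Row sums are at most \<open>c\<close> times the mass, and a class has finite mass; this
  makes reduced weights and degrees finite even for infinite classes.\<close>

lemma weighted_class_summable:
  assumes x: "x \<in> verts G"
  shows "(\<lambda>(y, z). ext_weight G y z) summable_on cls x \<times> verts G"
proof -
  have "(\<lambda>(y, z). ext_weight G y z) summable_on cls x \<times> UNIV"
  proof (rule summable_on_SigmaI)
    show "((\<lambda>z. case (y, z) of (y, z) \<Rightarrow> ext_weight G y z) has_sum (\<Sum>\<^sub>\<infinity>z. ext_weight G y z)) UNIV" for y
      using weight_summable[of y] by simp
    show "(\<lambda>y. \<Sum>\<^sub>\<infinity>z. ext_weight G y z) summable_on cls x"
      by (rule summable_on_comparison_test[OF summable_on_cmult_right[OF part.class_summable[of x], of c]])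
         (use weight_le weight_nonneg in \<open>auto intro: infsum_nonneg\<close>)
  qed (simp add: weight_nonneg)
  thus ?thesis by (rule summable_on_subset) auto
qed

text \<open>Dominated via t <= 1 + t^2: the constant part is the total weight of the rows of the
  class, the quadratic part is controlled by the norm of \<open>h\<close>.\<close>

lemma weighted_val_summable:
  assumes x: "x \<in> verts G"
  shows "(\<lambda>(y, z). ext_weight G y z *\<^sub>R val h z) summable_on cls x \<times> verts G"
proof (rule abs_summable_summable, rule summable_on_comparison_test)
  have "(\<lambda>(y, z). ext_weight G y z * (cmod (val h z))\<^sup>2) summable_on UNIV \<times> UNIV"
    using weight_fst_summable[of h] summable_on_swap[of "\<lambda>(x, y). ext_weight G x y * (cmod (val h x))\<^sup>2" UNIV UNIV]
    by (simp add: case_prod_unfold weight_sym)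
  hence "(\<lambda>(y, z). ext_weight G y z * (cmod (val h z))\<^sup>2) summable_on cls x \<times> verts G"
    by (rule summable_on_subset) auto
  from summable_on_add[OF weighted_class_summable[OF x] this]
  show "(\<lambda>(y, z). ext_weight G y z + ext_weight G y z * (cmod (val h z))\<^sup>2) summable_on cls x \<times> verts G"
    by (simp add: case_prod_unfold)
  fix p :: "'v \<times> 'v"
  obtain y z where p: "p = (y, z)" by fastforce
  have "cmod (val h z) \<le> 1 + (cmod (val h z))\<^sup>2"
    using sum_squares_bound[of 1 "cmod (val h z)"] norm_ge_zero[of "val h z"]
    unfolding one_power2 mult_1_right by linarith
  from mult_left_mono[OF this weight_nonneg[of y z]]
  show "norm (case p of (y, z) \<Rightarrow> ext_weight G y z *\<^sub>R val h z)
      \<le> (case p of (y, z) \<Rightarrow> ext_weight G y z + ext_weight G y z * (cmod (val h z))\<^sup>2)"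
    using weight_nonneg[of y z] by (simp add: p distrib_left)
qed auto

text \<open>Both sides are the double sum of w(y, z) (h(y) - h(z)) over y in \<open>cls x\<close>
  and all vertices z, divided by the class mass: grouped by the class of z it is the reduced
  Laplacian, grouped by y the mean of \<open>laplace h\<close>. Weights inside the class enter the
  reduced degree and adjacency alike and cancel.\<close>

lemma laplacian_red_class:
  assumes h: "h \<in> lifted" and x: "x \<in> verts G"
  shows "laplacian red (J_down G F (val h)) (cls x) = val (part.averaging \<bullet>\<^sub>e laplace h) x"
proof -
  define k where "k = J_down G F (val h)"
  have k: "k (cls z) = val h z" if "z \<in> verts G" for z
    unfolding k_def by (rule J_down_val[OF h that])
  have verts: "x \<in> verts G" "cls x \<subseteq> verts G" using x class_verts by auto
  have Un: "(\<Union>D\<in>verts red. cls x \<times> D) = cls x \<times> verts G"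
    using Union_verts_red by auto
  have disj: "disjoint_family_on (\<lambda>D. cls x \<times> D) (verts red)"
    using disjoint_verts_red by (auto simp: disjoint_family_on_def)
  have sub: "D \<subseteq> verts G" if "D \<in> verts red" for D using that Union_verts_red by auto
  have red_weight: "((\<lambda>(y, z). ext_weight G y z) has_sum weight red (cls x) D) (cls x \<times> D)"
    if D: "D \<in> verts red" for D
  proof -
    have "(\<lambda>(y, z). ext_weight G y z) summable_on cls x \<times> D"
      by (rule summable_on_subset[OF weighted_class_summable[OF x]]) (use sub[OF D] in auto)
    moreover have "weight red (cls x) D = infsum (\<lambda>(y, z). ext_weight G y z) (cls x \<times> D)"
      unfolding reduced_graph_def reduced_weight_def
      by (auto intro!: infsum_cong simp: ext_weight_def subsetD[OF verts(2)] subsetD[OF sub[OF D]])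
    ultimately show ?thesis by simp
  qed
  define W where "W = infsum (\<lambda>(y, z). ext_weight G y z) (cls x \<times> verts G)"
  have W: "((\<lambda>(y, z). ext_weight G y z) has_sum W) (cls x \<times> verts G)"
    unfolding W_def by (rule has_sum_infsum[OF weighted_class_summable[OF x]])
  have deg: "degree red (cls x) = W"
    unfolding degree_def
    by (rule infsumI, rule has_sum_UnionD[OF W[folded Un] red_weight disj])
  define Y where "Y = infsum (\<lambda>(y, z). ext_weight G y z *\<^sub>R val h z) (cls x \<times> verts G)"
  have Y: "((\<lambda>(y, z). ext_weight G y z *\<^sub>R val h z) has_sum Y) (cls x \<times> verts G)"
    unfolding Y_def by (rule has_sum_infsum[OF weighted_val_summable[OF x]])
  have "((\<lambda>D. of_real (weight red (cls x) D) * k D) has_sum Y) (verts red)"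
  proof (rule has_sum_UnionD[OF Y[folded Un] _ disj])
    fix D assume D: "D \<in> verts red"
    then obtain u where u: "u \<in> verts G" "D = cls u" by (auto simp: verts_red)
    have "val h z = k D" if "z \<in> D" for z
      using that u part.class_eq[of z u] class_verts[of u z] k[of z] by simp
    moreover have "((\<lambda>p. (case p of (y, z) \<Rightarrow> ext_weight G y z) *\<^sub>R k D) has_sum weight red (cls x) D *\<^sub>R k D) (cls x \<times> D)"
      by (rule has_sum_bounded_linear[OF bounded_linear_scaleR_left red_weight[OF D]])
    ultimately show "((\<lambda>(y, z). ext_weight G y z *\<^sub>R val h z) has_sum of_real (weight red (cls x) D) * k D) (cls x \<times> D)"
      by (subst has_sum_cong[where g = "\<lambda>p. (case p of (y, z) \<Rightarrow> ext_weight G y z) *\<^sub>R k D"])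
         (auto simp: scaleR_conv_of_real)
  qed
  hence sum: "(\<Sum>\<^sub>\<infinity>D\<in>verts red. of_real (weight red (cls x) D) * k D) = Y" by (rule infsumI)
  have "((\<lambda>p. (case p of (y, z) \<Rightarrow> ext_weight G y z) *\<^sub>R val h x
      + - (case p of (y, z) \<Rightarrow> ext_weight G y z *\<^sub>R val h z)) has_sum (W *\<^sub>R val h x + - Y)) (cls x \<times> verts G)"
    by (intro has_sum_add has_sum_uminusI Y has_sum_bounded_linear[OF bounded_linear_scaleR_left W])
  \<comment> \<open>Now the sum is taken over z first; \<open>val h x\<close> stands for
    \<open>val h y\<close> because \<open>h\<close> is constant on the class.\<close>
  hence "((\<lambda>y. ext_mass G y *\<^sub>R val (laplace h) y) has_sum (W *\<^sub>R val h x + - Y)) (cls x)"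
  proof (rule has_sum_SigmaD)
    fix y assume y: "y \<in> cls x"
    have yx: "val h y = val h x"
      using part.averaging_constant[OF y, of h] liftedD(2)[OF h] by simp
    have "((\<lambda>z. ext_weight G y z *\<^sub>R (val h y - val h z)) has_sum ext_mass G y *\<^sub>R val (laplace h) y) UNIV"
      using has_sum_infsum[OF abs_summable_summable[OF laplace_row_abs_summable[of y h]]] mass_pos[of y]
      by (simp add: l2_val_laplace scaleR_conv_of_real)
    thus "((\<lambda>z. (case (y, z) of (y, z) \<Rightarrow> ext_weight G y z) *\<^sub>R val h x
      + - (case (y, z) of (y, z) \<Rightarrow> ext_weight G y z *\<^sub>R val h z)) has_sum ext_mass G y *\<^sub>R val (laplace h) y) (verts G)"
      by (rule has_sum_cong_neutral[THEN iffD1, rotated -1])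
         (auto simp: yx scaleR_diff_right ext_weight_def)
  qed
  from has_sum_unique[OF part.l2_val_averaging this]
  have avg: "of_real (part.class_mass x) * val (part.averaging \<bullet>\<^sub>e laplace h) x = of_real W * val h x - Y"
    by (simp add: scaleR_conv_of_real)
  have lap: "laplacian red k (cls x)
      = 1 / of_real (part.class_mass x) * (of_real W * val h x - Y)"
    using x unfolding laplacian_def deg sum mass_red[OF x] k[OF x] by (simp add: verts_red)
  show ?thesis
    using part.class_mass_pos[of x] unfolding k_def[symmetric] lap avg[symmetric] by simp
qed

lemma compression_lifted:
  assumes "h \<in> supported_on (verts G)"
  shows "(part.averaging * laplace_endo * part.averaging) \<bullet>\<^sub>e h \<in> lifted"
  using assms
  by (simp add: endo_apply_mult laplace_endo_apply averaging_supported laplace_supported liftedD(1))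

lemma laplacian_red:
  assumes h: "h \<in> lifted"
  shows "laplacian red (J_down G F (val h))
    = J_down G F (val ((part.averaging * laplace_endo * part.averaging) \<bullet>\<^sub>e h))"
proof
  fix C
  show "laplacian red (J_down G F (val h)) C
    = J_down G F (val ((part.averaging * laplace_endo * part.averaging) \<bullet>\<^sub>e h)) C"
  proof (cases "C \<in> verts red")
    case True
    then obtain x where "x \<in> verts G" "C = cls x" by (auto simp: verts_red)
    thus ?thesis
      by (simp add: laplacian_red_class[OF h] J_down_averaging endo_apply_mult laplace_endo_apply
            liftedD(2)[OF h] J_down_class)
  next
    case False
    thus ?thesis by (simp add: laplacian_def J_down_outside)
  qed
qed

lemma J_down_val_linear:
  "J_down G F (val (h + k)) C = J_down G F (val h) C + J_down G F (val k) C"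
  "J_down G F (val (r *\<^sub>R h)) C = r *\<^sub>R J_down G F (val h) C"
  by (cases "C \<in> verts red";
      auto simp: verts_red J_down_class J_down_outside l2_val_linear endo.add_right endo.scaleR_right)+

text \<open>On \<open>lifted\<close>, \<open>J_down\<close> after \<open>val\<close> is an isometry
  onto \<open>ell2 red\<close> that intertwines the compression with the reduced Laplacian, and
  \<open>J_up\<close> undoes \<open>J_down\<close> there; a general \<open>h\<close> is averaged
  first, which \<open>J_down\<close> does not notice.\<close>

lemma J_up_heat_J_down:
  assumes h: "h \<in> supported_on (verts G)"
  shows "J_up G F (heat red t (J_down G F (val h)))
    = val (semigroup_exp (part.averaging * laplace_endo * part.averaging) t \<bullet>\<^sub>e (part.averaging \<bullet>\<^sub>e h))"
    and "semigroup_exp (part.averaging * laplace_endo * part.averaging) t \<bullet>\<^sub>e (part.averaging \<bullet>\<^sub>e h)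
      \<in> supported_on (verts G)"
proof -
  note transport = heat_transport[where \<Phi> = "\<lambda>h. J_down G F (val h)",
      OF subspace_lifted closed_lifted J_down_image ell2_norm_J_down_val J_down_val_linear
        compression_lifted[OF liftedD(1)] laplacian_red averaging_supported[OF h]]
  show "semigroup_exp (part.averaging * laplace_endo * part.averaging) t \<bullet>\<^sub>e (part.averaging \<bullet>\<^sub>e h)
      \<in> supported_on (verts G)"
    by (rule liftedD(1)[OF transport(2)])
  show "J_up G F (heat red t (J_down G F (val h)))
    = val (semigroup_exp (part.averaging * laplace_endo * part.averaging) t \<bullet>\<^sub>e (part.averaging \<bullet>\<^sub>e h))"
    using transport(1)[of t] J_up_J_down[OF transport(2)[of t]] by (simp add: J_down_averaging)
qed

end


section \<open>Clusters\<close>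

text \<open>Disjointness keeps a path inside the cluster where it starts, so a class lies in one
  cluster of finite mass or is a singleton.\<close>

lemma clusters_class_partition:
  assumes G: "weighted_graph G" and cl: "undirected_clusters G I Eh"
  defines "F \<equiv> (\<Union>i\<in>I. Eh i)"
  shows "class_partition (ext_mass G) (\<lambda>x. F\<^sup>* `` {x})"
proof
  fix x y
  show pos: "0 < ext_mass G x" for x using G by (simp add: weighted_graph_def ext_mass_def)
  show "x \<in> F\<^sup>* `` {x}" by simp
  have "sym (Eh i)" if "i \<in> I" for i using cl that by (simp add: undirected_clusters_def)
  hence "sym F" unfolding F_def by (rule sym_UNION[rule_format])
  hence "sym (F\<^sup>*)" by (rule sym_rtrancl)
  thus "y \<in> F\<^sup>* `` {x} \<Longrightarrow> F\<^sup>* `` {y} = F\<^sup>* `` {x}"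
    by (auto dest: symD intro: rtrancl_trans)
  have disj: "i = j" if "i \<in> I" "j \<in> I" "v \<in> Field (Eh i)" "v \<in> Field (Eh j)" for i j v
    using cl that unfolding undirected_clusters_def disjoint_family_on_def by blast
  have step: "y = x \<or> (\<exists>i\<in>I. x \<in> Field (Eh i) \<and> y \<in> Field (Eh i))" if "(x, y) \<in> F\<^sup>*" for y
    using that
  proof (induction rule: rtrancl_induct)
    case (step y z)
    obtain j where j: "j \<in> I" "(y, z) \<in> Eh j" using step.hyps(2) by (auto simp: F_def)
    hence yz: "y \<in> Field (Eh j)" "z \<in> Field (Eh j)" by (auto simp: Field_def)
    show ?case
    proof (cases "y = x")
      case True
      thus ?thesis using j yz by blast
    next
      case False
      then obtain i where i: "i \<in> I" "x \<in> Field (Eh i)" "y \<in> Field (Eh i)" using step.IH by blast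
      hence "i = j" using disj j(1) yz(1) by blast
      thus ?thesis using i yz by blast
    qed
  qed simp
  have "\<exists>A. F\<^sup>* `` {x} \<subseteq> A \<and> ext_mass G summable_on A"
  proof (cases "\<exists>i\<in>I. x \<in> Field (Eh i)")
    case True
    then obtain i where i: "i \<in> I" "x \<in> Field (Eh i)" by blast
    have "y \<in> Field (Eh i)" if "(x, y) \<in> F\<^sup>*" for y
      using step[OF that] i disj by blast
    moreover have "ext_mass G summable_on Field (Eh i)"
    proof -
      have "Eh i \<subseteq> verts G \<times> verts G"
        using cl i(1) G unfolding undirected_clusters_def weighted_graph_def by (meson order_trans)
      hence "v \<in> verts G" if "v \<in> Field (Eh i)" for v using that by (auto simp: Field_def)
      hence "ext_mass G summable_on Field (Eh i) \<longleftrightarrow> mass G summable_on Field (Eh i)"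
        by (intro summable_on_cong) (simp add: ext_mass_def)
      thus ?thesis using cl i(1) by (simp add: undirected_clusters_def)
    qed
    ultimately show ?thesis by auto
  next
    case False
    thus ?thesis using step by (intro exI[of _ "{x}"]) auto
  qed
  thus "ext_mass G summable_on F\<^sup>* `` {x}" using summable_on_subset by blast
qed

theorem corollary3p9:
  fixes G :: "'v wgraph"
    and I :: "'i set"
    and Eh :: "'i \<Rightarrow> ('v \<times> 'v) set"
    and Ehat :: "('v \<times> 'v) set"
    and a :: "real \<Rightarrow> 'v \<Rightarrow> 'v \<Rightarrow> real"
    and G\<beta> :: "real \<Rightarrow> 'v wgraph"
    and t :: real
  assumes "weighted_graph G" and "undirected G" and "degree_bounded G"
    and "undirected_clusters G I Eh"
    and Ehat: "Ehat = (\<Union>i\<in>I. Eh i)"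
    and G\<beta>: "\<And>\<beta>. G\<beta> \<beta> = G\<lparr>weight := a \<beta>\<rparr>"
    and "\<And>\<beta>. \<beta> \<ge> 0 \<Longrightarrow> weighted_graph (G\<beta> \<beta>)"
    and "\<And>\<beta>. \<beta> \<ge> 0 \<Longrightarrow> undirected (G\<beta> \<beta>)"
    and "\<And>\<beta>. \<beta> \<ge> 0 \<Longrightarrow> degree_bounded (G\<beta> \<beta>)"
    and "\<And>i j. i \<in> verts G \<Longrightarrow> j \<in> verts G \<Longrightarrow> a 0 i j = weight G i j"
    and "\<And>\<beta> \<beta>' i j. 0 \<le> \<beta> \<Longrightarrow> \<beta> < \<beta>' \<Longrightarrow> (i, j) \<in> edges G - Ehat \<Longrightarrow>
           a \<beta>' i j = weight G i j"
    and "\<And>\<beta> \<beta>' i j. 0 \<le> \<beta> \<Longrightarrow> \<beta> < \<beta>' \<Longrightarrow> (i, j) \<in> Ehat \<Longrightarrow>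
           a \<beta>' i j > a \<beta> i j"
    and "\<And>i j. (i, j) \<in> Ehat \<Longrightarrow> filterlim (\<lambda>\<beta>. a \<beta> i j) at_top at_top"
    and "t > 0"
  shows "strong_op_tendsto G (\<lambda>\<beta>. heat (G\<beta> \<beta>) t)
           (\<lambda>f. J_up G Ehat (heat (reduced_graph G Ehat) t (J_down G Ehat f))) at_top"
proof -
  \<comment> \<open>The graphs are controlled for nonnegative parameters only, while the limit
    theorem takes a family over all reals; clamping at 0 changes nothing for large \<beta>.\<close>
  define H where "H \<beta> = G\<beta> (max 0 \<beta>)" for \<beta>
  \<comment> \<open>For positive \<beta>, edges outside the clusters use the hypothesis with base
    parameter 0, and non-edges have weight 0 in both graphs because the edge set is shared. All
    other parameters are clamped to \<open>a 0\<close>.\<close>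
  have weight_off: "ext_weight (H \<beta>) x y = ext_weight G x y" if "(x, y) \<notin> Ehat" for \<beta> x y
  proof (cases "x \<in> verts G \<and> y \<in> verts G")
    case True
    have "a (max 0 \<beta>) x y = weight G x y"
    proof (cases "\<beta> > 0")
      case pos: True
      show ?thesis
      proof (cases "(x, y) \<in> edges G")
        case edge: True
        thus ?thesis using assms(11)[of 0 \<beta> x y] pos that by simp
      next
        case False
        have "\<not> 0 < weight (H \<beta>) x y" "0 \<le> weight (H \<beta>) x y"
          using assms(7)[of \<beta>] False True pos by (auto simp: weighted_graph_def G\<beta> H_def)
        moreover have "\<not> 0 < weight G x y" "0 \<le> weight G x y"
          using assms(1) False True by (auto simp: weighted_graph_def)
        ultimately show ?thesis by (simp add: H_def G\<beta>)
      qed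
    next
      case False
      hence "max 0 \<beta> = 0" by simp
      thus ?thesis using assms(10) True by simp
    qed
    thus ?thesis using True by (simp add: ext_weight_def H_def G\<beta>)
  qed (auto simp: ext_weight_def H_def G\<beta>)
  have ext_mass_H: "ext_mass (H \<beta>) = ext_mass G" and verts_H: "verts (H \<beta>) = verts G" for \<beta>
    by (auto simp: ext_mass_def H_def G\<beta>)
  have Ehat_edges: "Ehat \<subseteq> edges G"
    using assms(4) unfolding Ehat undirected_clusters_def by blast
  hence Ehat_verts: "Ehat \<subseteq> verts G \<times> verts G"
    using assms(1) by (auto simp: weighted_graph_def)
  have diverge: "filterlim (\<lambda>\<beta>. ext_weight (H \<beta>) x y) at_top at_top" if "(x, y) \<in> Ehat" for x y
  proof (rule filterlim_cong[THEN iffD1, OF refl refl _ assms(13)[OF that]])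
    show "\<forall>\<^sub>F \<beta> in at_top. a \<beta> x y = ext_weight (H \<beta>) x y"
      using eventually_ge_at_top[of 0]
      by eventually_elim (use that Ehat_verts in \<open>auto simp: ext_weight_def H_def G\<beta>\<close>)
  qed
  obtain c0 where c0: "bounded_weight (ext_mass G) (ext_weight G) c0"
    using graph_bounded_weight assms(1-3) by blast
  have "\<exists>c. bounded_weight (ext_mass G) (ext_weight (H \<beta>)) c" for \<beta>
    using graph_bounded_weight[of "H \<beta>"] assms(7-9)[of "max 0 \<beta>"] by (simp add: ext_mass_H H_def[symmetric])
  then obtain c where c: "\<And>\<beta>. bounded_weight (ext_mass G) (ext_weight (H \<beta>)) (c \<beta>)" by metis
  have part: "class_partition (ext_mass G) (\<lambda>x. Ehat\<^sup>* `` {x})"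
    unfolding Ehat by (rule clusters_class_partition[OF assms(1,4)])
  interpret clustered_graph G c0 Ehat
    by (intro clustered_graph.intro bounded_graph.intro clustered_graph_axioms.intro c0 part Ehat_verts)
  \<comment> \<open>All graphs share vertices and masses, so their semigroups act on the same
    subspace of \<open>l2\<close>.\<close>
  interpret H: bounded_graph "H \<beta>" "c \<beta>" for \<beta>
    using c[of \<beta>] by (simp add: bounded_graph_def ext_mass_H)
  show ?thesis
    unfolding strong_op_tendsto_def
  proof
    fix f assume "f \<in> ell2 G"
    then obtain h where h: "h \<in> supported_on (verts G)" and f: "f = val h" by (rule ell2_ex_val)
    define u where "u \<beta> = semigroup_exp (H.laplace_endo \<beta>) t \<bullet>\<^sub>e h" for \<beta>
    define u0 where "u0 = semigroup_exp (part.averaging * laplace_endo * part.averaging) t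
        \<bullet>\<^sub>e (part.averaging \<bullet>\<^sub>e h)"
    have heat_H: "heat (H \<beta>) t f = val (u \<beta>)" and u: "u \<beta> \<in> supported_on (verts G)" for \<beta>
      unfolding u_def f using H.heat_val[of h \<beta> t] h by (simp_all add: verts_H ext_mass_H)
    have heat: "\<forall>\<^sub>F \<beta> in at_top. heat (G\<beta> \<beta>) t f = val (u \<beta>)"
      using eventually_ge_at_top[of 0]
    proof eventually_elim
      case (elim \<beta>)
      thus ?case using heat_H[of \<beta>] by (simp add: H_def max_absorb2)
    qed
    have limit: "J_up G Ehat (heat (reduced_graph G Ehat) t (J_down G Ehat f)) = val u0"
      and u0: "u0 \<in> supported_on (verts G)"
      unfolding u0_def f using J_up_heat_J_down[OF h] by simp_all
    have "(u \<longlongrightarrow> u0) at_top"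
      unfolding u_def[abs_def] u0_def
      using laplace_semigroup_tendsto[OF part c c0 _ diverge \<open>t > 0\<close>, of h] weight_off
      by (simp add: ext_mass_H) blast
    hence "((\<lambda>\<beta>. norm (u \<beta> - u0)) \<longlongrightarrow> 0) at_top"
      by (simp add: tendsto_norm_zero_iff LIM_zero_iff)
    moreover have "(\<lambda>v. val (u \<beta>) v - val u0 v) = val (u \<beta> - u0)" for \<beta>
      by (simp add: l2_val_linear fun_eq_iff)
    ultimately have "((\<lambda>\<beta>. ell2_norm G (\<lambda>v. val (u \<beta>) v - val u0 v)) \<longlongrightarrow> 0) at_top"
      by (simp add: ell2_norm_val subspace_diff[OF subspace_supported_on] u u0)
    hence "((\<lambda>\<beta>. ell2_norm G (\<lambda>v. heat (G\<beta> \<beta>) t f v - val u0 v)) \<longlongrightarrow> 0) at_top"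
      by (rule Lim_transform_eventually) (use heat in eventually_elim, simp)
    moreover have "\<forall>\<^sub>F \<beta> in at_top. heat (G\<beta> \<beta>) t f \<in> ell2 G"
      using heat by eventually_elim (simp add: val_ell2 u)
    ultimately show "ell2_tendsto G (\<lambda>\<beta>. heat (G\<beta> \<beta>) t f)
        (J_up G Ehat (heat (reduced_graph G Ehat) t (J_down G Ehat f))) at_top"
      unfolding ell2_tendsto_def limit by (simp add: val_ell2 u0)
  qed
qed

end
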